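(* Let $\mathcal{H}_1,\dots,\mathcal{H}_m$ be separable Hilbert spaces and $K_j\in\mathcal{L}(\mathcal{H}_j)$ for $j=1,\dots,m$. For each $j=1,\dots,m$ let $\{(\mathcal{W}_{ij},v_i)\}_{i\in I}$ be a $K_j$-fusion frame for $\mathcal{H}_j$ (with the same weights $v_i$ for all $j$), where $\mathcal{W}_{ij}\cap\mathcal{W}_{ik}=\{0\}$ for $j\ne k$ when these are regarded as subspaces of $\bigoplus_{j=1}^m\mathcal{H}_j$. Then $\left\{\left(\bigoplus_{j=1}^m\mathcal{W}_{ij},v_i\right)\right\}_{i\in I}$ is a $\bigoplus_{j=1}^mK_j$-fusion frame for the Hilbert space $\bigoplus_{j=1}^m\mathcal{H}_j$.
   Context: The index set $I$ is finite or countable. $\mathcal{L}(\mathcal{H})$ is the space of bounded linear operators on $\mathcal{H}$; $P_{\mathcal{W}}$ denotes the orthogonal projection onto the closed subspace $\mathcal{W}$. For closed subspaces $\mathcal{W}_i$ of a Hilbert space $\mathcal{H}$, positive weights $v_i$ and $K\in\mathcal{L}(\mathcal{H})$, $\{(\mathcal{W}_i,v_i)\}_{i\in I}$ is a $K$-fusion frame for $\mathcal{H}$ if there are $A,B>0$ with $A\|K^*f\|^2\le\sum_{i\in I}v_i^2\|P_{\mathcal{W}_i}f\|^2\le B\|f\|^2$ for all $f\in\mathcal{H}$. $\bigoplus_{j=1}^m\mathcal{H}_j$ is the orthogonal Hilbert space direct sum, with $\|f_1\oplus\cdots\oplus f_m\|^2=\sum_j\|f_j\|^2$, and the direct sum operator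 $\bigoplus_{j=1}^mK_j$ acts by $f_1\oplus\cdots\oplus f_m\mapsto K_1f_1\oplus\cdots\oplus K_mf_m$. *)

theory Defs
  imports "HOL-Analysis.Analysis" "HOL-Algebra.Module"
begin

text \<open>
  Hilbert spaces are explicit carriers rather than types, so that a finite family
  \<open>H 1, \<dots>, H m\<close> of different spaces, and its direct sum, can be formed for a variable \<open>m\<close>.
  The scalar field \<open>F\<close> is \<open>\<real>\<close> or \<open>\<complex>\<close>, given as a subset of the complex numbers.
\<close>

definition scalar_ring :: "complex set \<Rightarrow> complex ring" where
  "scalar_ring F = \<lparr>carrier = F, mult = (*), one = 1, zero = 0, add = (+)\<rparr>"

record 'a hspace = "(complex, 'a) module" +
  hinner :: "'a \<Rightarrow> 'a \<Rightarrow> complex"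

definition hnorm :: "'a hspace \<Rightarrow> 'a \<Rightarrow> real" where
  "hnorm H x = sqrt (Re (hinner H x x))"

text \<open>
  The locale \<open>Metric_space\<close> asks for symmetry and nonnegativity on the whole type, hence the
  value \<open>0\<close> outside the carrier.
\<close>

definition hdist :: "'a hspace \<Rightarrow> 'a \<Rightarrow> 'a \<Rightarrow> real" where
  "hdist H x y = (if x \<in> carrier H \<and> y \<in> carrier H then hnorm H (x \<ominus>\<^bsub>H\<^esub> y) else 0)"

abbreviation htopology :: "'a hspace \<Rightarrow> 'a topology" where
  "htopology H \<equiv> Metric_space.mtopology (carrier H) (hdist H)"

locale hilbert_space =
  fixes F :: "complex set" and H :: "'a hspace"
  assumes scalars: "F = \<real> \<or> F = UNIV"
    and vector_space: "Module.module (scalar_ring F) H"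
    and inner_scalar: "\<lbrakk>x \<in> carrier H; y \<in> carrier H\<rbrakk> \<Longrightarrow> hinner H x y \<in> F"
    and inner_add_left: "\<lbrakk>x \<in> carrier H; y \<in> carrier H; z \<in> carrier H\<rbrakk> \<Longrightarrow>
          hinner H (x \<oplus>\<^bsub>H\<^esub> y) z = hinner H x z + hinner H y z"
    and inner_smult_left: "\<lbrakk>c \<in> F; x \<in> carrier H; y \<in> carrier H\<rbrakk> \<Longrightarrow>
          hinner H (c \<odot>\<^bsub>H\<^esub> x) y = c * hinner H x y"
    and inner_cnj: "\<lbrakk>x \<in> carrier H; y \<in> carrier H\<rbrakk> \<Longrightarrow> hinner H x y = cnj (hinner H y x)"
    and inner_nonneg: "x \<in> carrier H \<Longrightarrow> 0 \<le> Re (hinner H x x)"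
    and inner_eq_zero: "\<lbrakk>x \<in> carrier H; hinner H x x = 0\<rbrakk> \<Longrightarrow> x = \<zero>\<^bsub>H\<^esub>"
    and complete: "Metric_space.mcomplete (carrier H) (hdist H)"

definition closed_subspace :: "complex set \<Rightarrow> 'a hspace \<Rightarrow> 'a set \<Rightarrow> bool" where
  "closed_subspace F H W \<longleftrightarrow> submodule W (scalar_ring F) H \<and> closedin (htopology H) W"

definition bounded_operator :: "complex set \<Rightarrow> 'a hspace \<Rightarrow> ('a \<Rightarrow> 'a) \<Rightarrow> bool" where
  "bounded_operator F H K \<longleftrightarrow>
     K \<in> carrier H \<rightarrow> carrier H \<and>
     (\<forall>x\<in>carrier H. \<forall>y\<in>carrier H. K (x \<oplus>\<^bsub>H\<^esub> y) = K x \<oplus>\<^bsub>H\<^esub> K y) \<and>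
     (\<forall>c\<in>F. \<forall>x\<in>carrier H. K (c \<odot>\<^bsub>H\<^esub> x) = c \<odot>\<^bsub>H\<^esub> K x) \<and>
     (\<exists>C. \<forall>x\<in>carrier H. hnorm H (K x) \<le> C * hnorm H x)"

definition adjoint_op :: "'a hspace \<Rightarrow> ('a \<Rightarrow> 'a) \<Rightarrow> 'a \<Rightarrow> 'a" where
  "adjoint_op H K g =
     (THE h. h \<in> carrier H \<and> (\<forall>f\<in>carrier H. hinner H (K f) g = hinner H f h))"

definition orth_proj :: "'a hspace \<Rightarrow> 'a set \<Rightarrow> 'a \<Rightarrow> 'a" where
  "orth_proj H W f = (THE p. p \<in> W \<and> (\<forall>w\<in>W. hinner H (f \<ominus>\<^bsub>H\<^esub> p) w = 0))"

text \<open>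
  Summability is required separately because \<open>infsum\<close> is \<open>0\<close> for families that are not summable.
\<close>

definition K_fusion_frame ::
    "complex set \<Rightarrow> 'a hspace \<Rightarrow> ('a \<Rightarrow> 'a) \<Rightarrow> 'i set \<Rightarrow> ('i \<Rightarrow> 'a set) \<Rightarrow> ('i \<Rightarrow> real) \<Rightarrow> bool" where
  "K_fusion_frame F H K I W v \<longleftrightarrow>
     hilbert_space F H \<and> bounded_operator F H K \<and>
     (\<forall>i\<in>I. closed_subspace F H (W i)) \<and> (\<forall>i\<in>I. 0 < v i) \<and>
     (\<exists>A>0. \<exists>B>0. \<forall>f\<in>carrier H.
        (\<lambda>i. (v i)\<^sup>2 * (hnorm H (orth_proj H (W i) f))\<^sup>2) summable_on I \<and>
        A * (hnorm H (adjoint_op H K f))\<^sup>2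
          \<le> (\<Sum>\<^sub>\<infinity>i\<in>I. (v i)\<^sup>2 * (hnorm H (orth_proj H (W i) f))\<^sup>2) \<and>
        (\<Sum>\<^sub>\<infinity>i\<in>I. (v i)\<^sup>2 * (hnorm H (orth_proj H (W i) f))\<^sup>2) \<le> B * (hnorm H f)\<^sup>2)"

text \<open>
  The record of a module also has the ring operations \<open>mult\<close> and \<open>one\<close>; they play no role in a
  vector space and are left unspecified.  Elements of the direct sum are extensional functions on
  \<open>{1..m}\<close>.
\<close>

definition direct_sum :: "nat \<Rightarrow> (nat \<Rightarrow> 'a hspace) \<Rightarrow> (nat \<Rightarrow> 'a) hspace" where
  "direct_sum m H =
     \<lparr>carrier = (\<Pi>\<^sub>E j\<in>{1..m}. carrier (H j)),
      mult = undefined, one = undefined,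
      zero = (\<lambda>j\<in>{1..m}. \<zero>\<^bsub>H j\<^esub>),
      add = (\<lambda>f g. \<lambda>j\<in>{1..m}. f j \<oplus>\<^bsub>H j\<^esub> g j),
      smult = (\<lambda>c f. \<lambda>j\<in>{1..m}. c \<odot>\<^bsub>H j\<^esub> f j),
      hinner = (\<lambda>f g. \<Sum>j\<in>{1..m}. hinner (H j) (f j) (g j))\<rparr>"

definition direct_sum_subspace :: "nat \<Rightarrow> (nat \<Rightarrow> 'a set) \<Rightarrow> (nat \<Rightarrow> 'a) set" where
  "direct_sum_subspace m W = (\<Pi>\<^sub>E j\<in>{1..m}. W j)"

definition direct_sum_op :: "nat \<Rightarrow> (nat \<Rightarrow> 'a \<Rightarrow> 'a) \<Rightarrow> (nat \<Rightarrow> 'a) \<Rightarrow> (nat \<Rightarrow> 'a)" where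
  "direct_sum_op m K f = (\<lambda>j\<in>{1..m}. K j (f j))"

definition direct_sum_embed :: "nat \<Rightarrow> (nat \<Rightarrow> 'a hspace) \<Rightarrow> nat \<Rightarrow> 'a \<Rightarrow> (nat \<Rightarrow> 'a)" where
  "direct_sum_embed m H j x = (\<lambda>l\<in>{1..m}. if l = j then x else \<zero>\<^bsub>H l\<^esub>)"

end

(* Projections and adjoints are only specified by their characteristic orthogonality and duality
   properties, so their existence has to be secured first: closest points exist by the parallelogram
   law and completeness, and projecting onto the kernel of a bounded functional gives the Riesz
   representation, hence the adjoint.  The characteristic properties then show that projection and
   adjoint on the direct sum act componentwise; since squared norms add up over the components, the
   frame inequalities add up too, with the smallest lower and the largest upper bound. *)
theory Submission
  imports Defs
begin

text \<open>The definite descriptions split the work. Uniqueness is pure inner product algebra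
  (\<open>orth_proj_eqI\<close>, \<open>adjoint_op_eqI\<close>) and turns any vector with the
  characteristic property into the described value. Existence rests on completeness and is drawn
  from each \<open>H j\<close>, where it supplies the components of the candidate in the sum.
  Completeness of the sum has to be proved as well, because being a Hilbert space is part of the
  conclusion. Hence one locale without and one with completeness. Completeness of the sum and
  closedness of the subspaces in it come from a single fact: norm convergence in a finite orthogonal
  sum is convergence in each component (\<open>direct_sum_tendsto_iff\<close>). The frame sum is a
  series over \<open>I\<close>, the components are finitely many. For each \<open>i\<close> the
  squared norm of the projection is a finite sum over \<open>j\<close> with the common factor
  \<open>v i\<close> squared; this is where the shared weights enter, and the finite sum then leaves
  the series together with its convergence.\<close>

text \<open>
  The axioms of \<open>hilbert_space\<close> without completeness: the direct sum has to be known as a metric space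
  before its completeness can be discussed.
\<close>

locale inner_space =
  fixes F :: "complex set" and H :: "'a hspace"
  assumes scalars: "F = \<real> \<or> F = UNIV"
    and vector_space: "Module.module (scalar_ring F) H"
    and inner_scalar: "\<lbrakk>x \<in> carrier H; y \<in> carrier H\<rbrakk> \<Longrightarrow> hinner H x y \<in> F"
    and inner_add_left: "\<lbrakk>x \<in> carrier H; y \<in> carrier H; z \<in> carrier H\<rbrakk> \<Longrightarrow>
          hinner H (x \<oplus>\<^bsub>H\<^esub> y) z = hinner H x z + hinner H y z"
    and inner_smult_left: "\<lbrakk>c \<in> F; x \<in> carrier H; y \<in> carrier H\<rbrakk> \<Longrightarrow>
          hinner H (c \<odot>\<^bsub>H\<^esub> x) y = c * hinner H x y"
    and inner_cnj: "\<lbrakk>x \<in> carrier H; y \<in> carrier H\<rbrakk> \<Longrightarrow> hinner H x y = cnj (hinner H y x)"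
    and inner_nonneg: "x \<in> carrier H \<Longrightarrow> 0 \<le> Re (hinner H x x)"
    and inner_eq_zero: "\<lbrakk>x \<in> carrier H; hinner H x x = 0\<rbrakk> \<Longrightarrow> x = \<zero>\<^bsub>H\<^esub>"

sublocale hilbert_space \<subseteq> inner_space
  by (intro inner_space.intro) (fact scalars vector_space inner_scalar inner_add_left
    inner_smult_left inner_cnj inner_nonneg inner_eq_zero)+

sublocale inner_space \<subseteq> Module.module "scalar_ring F" H
  by (rule vector_space)

lemma scalar_ring_simps [simp]:
  "carrier (scalar_ring F) = F" "a \<oplus>\<^bsub>scalar_ring F\<^esub> b = a + b"
  "a \<otimes>\<^bsub>scalar_ring F\<^esub> b = a * b" "\<zero>\<^bsub>scalar_ring F\<^esub> = 0" "\<one>\<^bsub>scalar_ring F\<^esub> = 1"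
  by (simp_all add: scalar_ring_def)

lemma (in module) submodule_zero_closed: "submodule W R M \<Longrightarrow> \<zero>\<^bsub>M\<^esub> \<in> W"
  unfolding submodule_def using subgroup.one_closed[of W "add_monoid M"] by simp

lemma (in module) submodule_diff_closed:
  "\<lbrakk>submodule W R M; x \<in> W; y \<in> W\<rbrakk> \<Longrightarrow> x \<ominus>\<^bsub>M\<^esub> y \<in> W"
  by (simp add: M.minus_eq submoduleE)

lemma (in abelian_group) minus_eq_zero_iff [simp]:
  assumes "x \<in> carrier G" "y \<in> carrier G"
  shows "x \<ominus> y = \<zero> \<longleftrightarrow> x = y"
  using assms minus_equality[of x "\<ominus> y"] by (auto simp: minus_eq r_neg)

section \<open>Inner product algebra, the Cauchy-Schwarz inequality and the norm\<close>

context inner_space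
begin

text \<open>Closure of \<open>F\<close> under the operations used below; the analytic arguments
  appeal to such rules and so treat real and complex scalars at once.\<close>

lemma of_real_scalar [simp, intro]: "of_real r \<in> F"
  using scalars by auto

lemma cnj_scalar [simp, intro]: "c \<in> F \<Longrightarrow> cnj c \<in> F"
  using scalars by (auto elim!: Reals_cases)

lemma mult_scalar [simp, intro]: "\<lbrakk>c \<in> F; d \<in> F\<rbrakk> \<Longrightarrow> c * d \<in> F"
  using scalars by auto

lemma divide_scalar [simp, intro]: "\<lbrakk>c \<in> F; d \<in> F\<rbrakk> \<Longrightarrow> c / d \<in> F"
  using scalars by auto

lemma smult_carrier [simp, intro]: "\<lbrakk>c \<in> F; x \<in> carrier H\<rbrakk> \<Longrightarrow> c \<odot>\<^bsub>H\<^esub> x \<in> carrier H"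
  using smult_closed by simp

lemma inner_zero_left [simp]: "y \<in> carrier H \<Longrightarrow> hinner H \<zero>\<^bsub>H\<^esub> y = 0"
  using inner_add_left[of "\<zero>\<^bsub>H\<^esub>" "\<zero>\<^bsub>H\<^esub>" y] by simp

lemma inner_neg_left [simp]:
  assumes "x \<in> carrier H" "y \<in> carrier H"
  shows "hinner H (\<ominus>\<^bsub>H\<^esub> x) y = - hinner H x y"
  using inner_add_left[of "\<ominus>\<^bsub>H\<^esub> x" x y] assms by (simp add: M.l_neg eq_neg_iff_add_eq_0)

lemma inner_diff_left:
  "\<lbrakk>x \<in> carrier H; y \<in> carrier H; z \<in> carrier H\<rbrakk> \<Longrightarrow>
     hinner H (x \<ominus>\<^bsub>H\<^esub> y) z = hinner H x z - hinner H y z"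
  by (simp add: a_minus_def inner_add_left)

lemma inner_zero_right [simp]: "y \<in> carrier H \<Longrightarrow> hinner H y \<zero>\<^bsub>H\<^esub> = 0"
  using inner_cnj[of y "\<zero>\<^bsub>H\<^esub>"] by simp

lemma inner_add_right:
  "\<lbrakk>x \<in> carrier H; y \<in> carrier H; z \<in> carrier H\<rbrakk> \<Longrightarrow>
     hinner H z (x \<oplus>\<^bsub>H\<^esub> y) = hinner H z x + hinner H z y"
  using inner_cnj[of z "x \<oplus>\<^bsub>H\<^esub> y"] inner_cnj[of z x] inner_cnj[of z y]
  by (simp add: inner_add_left)

lemma inner_diff_right:
  "\<lbrakk>x \<in> carrier H; y \<in> carrier H; z \<in> carrier H\<rbrakk> \<Longrightarrow>
     hinner H z (x \<ominus>\<^bsub>H\<^esub> y) = hinner H z x - hinner H z y"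
  using inner_cnj[of z "x \<ominus>\<^bsub>H\<^esub> y"] inner_cnj[of z x] inner_cnj[of z y]
  by (simp add: inner_diff_left)

lemma inner_smult_right:
  "\<lbrakk>c \<in> F; x \<in> carrier H; y \<in> carrier H\<rbrakk> \<Longrightarrow> hinner H y (c \<odot>\<^bsub>H\<^esub> x) = cnj c * hinner H y x"
  using inner_cnj[of y "c \<odot>\<^bsub>H\<^esub> x"] inner_cnj[of y x] by (simp add: inner_smult_left)

lemmas inner_simps = inner_add_left inner_add_right inner_diff_left inner_diff_right
  inner_smult_left inner_smult_right

text \<open>Testing against \<open>z = x \<ominus> y\<close> makes the difference orthogonal to
  itself. The lemma reduces identities between vectors to arithmetic with complex numbers.\<close>

lemma inner_ext:
  assumes "x \<in> carrier H" "y \<in> carrier H" "\<And>z. z \<in> carrier H \<Longrightarrow> hinner H x z = hinner H y z"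
  shows "x = y"
proof -
  have "x \<ominus>\<^bsub>H\<^esub> y = \<zero>\<^bsub>H\<^esub>"
    using assms by (intro inner_eq_zero) (simp_all add: inner_diff_left del: M.minus_eq_zero_iff)
  then show ?thesis
    using assms by simp
qed

lemma hnorm_nonneg [simp]: "x \<in> carrier H \<Longrightarrow> 0 \<le> hnorm H x"
  by (simp add: hnorm_def inner_nonneg)

lemma hnorm_sq: "x \<in> carrier H \<Longrightarrow> (hnorm H x)\<^sup>2 = Re (hinner H x x)"
  by (simp add: hnorm_def inner_nonneg)

text \<open>Conjugate symmetry removes the imaginary part of \<open>hinner H x x\<close>.\<close>

lemma inner_self: "x \<in> carrier H \<Longrightarrow> hinner H x x = of_real ((hnorm H x)\<^sup>2)"
  using inner_cnj[of x x] by (simp add: hnorm_sq complex_eq_iff)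

lemma hnorm_eq_zero_iff [simp]: "x \<in> carrier H \<Longrightarrow> hnorm H x = 0 \<longleftrightarrow> x = \<zero>\<^bsub>H\<^esub>"
  using inner_self[of x] inner_eq_zero[of x] by (auto simp: hnorm_def)

lemma hnorm_smult: 
  assumes "c \<in> F" "x \<in> carrier H"
  shows "hnorm H (c \<odot>\<^bsub>H\<^esub> x) = cmod c * hnorm H x"
proof -
  have "hinner H (c \<odot>\<^bsub>H\<^esub> x) (c \<odot>\<^bsub>H\<^esub> x) = c * cnj c * of_real ((hnorm H x)\<^sup>2)"
    using assms by (simp add: inner_simps inner_self[of x])
  also have "c * cnj c = of_real ((cmod c)\<^sup>2)"
    by (rule complex_norm_square[symmetric])
  finally have "hinner H (c \<odot>\<^bsub>H\<^esub> x) (c \<odot>\<^bsub>H\<^esub> x) = of_real ((cmod c * hnorm H x)\<^sup>2)"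
    by (simp add: power_mult_distrib)
  then show ?thesis
    using assms by (simp add: hnorm_def[of H "c \<odot>\<^bsub>H\<^esub> x"])
qed

lemma hnorm_diff_sq:
  "\<lbrakk>x \<in> carrier H; y \<in> carrier H\<rbrakk> \<Longrightarrow>
     (hnorm H (x \<ominus>\<^bsub>H\<^esub> y))\<^sup>2 = (hnorm H x)\<^sup>2 - 2 * Re (hinner H x y) + (hnorm H y)\<^sup>2"
  using inner_cnj[of x y] by (simp add: hnorm_sq inner_simps)

lemma hnorm_add_sq:
  "\<lbrakk>x \<in> carrier H; y \<in> carrier H\<rbrakk> \<Longrightarrow>
     (hnorm H (x \<oplus>\<^bsub>H\<^esub> y))\<^sup>2 = (hnorm H x)\<^sup>2 + 2 * Re (hinner H x y) + (hnorm H y)\<^sup>2"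
  using inner_cnj[of x y] by (simp add: hnorm_sq inner_simps)

lemma Cauchy_Schwarz:
  assumes x: "x \<in> carrier H" and y: "y \<in> carrier H"
  shows "cmod (hinner H x y) \<le> hnorm H x * hnorm H y"
proof (cases "y = \<zero>\<^bsub>H\<^esub>")
  case True
  then show ?thesis using assms by simp
next
  case False
  define a where "a = hinner H x y"
  define n where "n = (hnorm H y)\<^sup>2"
  have n: "n > 0" using False y by (simp add: n_def)
  have a: "a \<in> F" using assms by (simp add: a_def inner_scalar)
  have c: "a / of_real n \<in> F" using a by simp
  \<comment> \<open>The vector \<open>(a / n) \<odot> y\<close> is the projection of
    \<open>x\<close> onto the line spanned by \<open>y\<close>. After expansion the two correction
    terms are -2 and +1 times \<open>(cmod a)\<^sup>2 / n\<close>, which leaves the inequality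
    sought.\<close>
  have "0 \<le> (hnorm H (x \<ominus>\<^bsub>H\<^esub> (a / of_real n) \<odot>\<^bsub>H\<^esub> y))\<^sup>2" by simp
  also have "\<dots> = (hnorm H x)\<^sup>2 - 2 * Re (cnj (a / of_real n) * a) + (cmod a / n)\<^sup>2 * n"
    using x y c n by (simp add: hnorm_diff_sq hnorm_smult inner_simps power_mult_distrib norm_divide
      power_divide flip: a_def n_def)
  also have "Re (cnj (a / of_real n) * a) = (cmod a)\<^sup>2 / n"
    using n unfolding cmod_power2 by (simp add: power2_eq_square field_simps)
  also have "(cmod a / n)\<^sup>2 * n = (cmod a)\<^sup>2 / n"
    using n by (simp add: power2_eq_square)
  finally have "(cmod a)\<^sup>2 \<le> (hnorm H x)\<^sup>2 * n"
    using n by (simp add: field_simps)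
  then have "(cmod a)\<^sup>2 \<le> (hnorm H x * hnorm H y)\<^sup>2" by (simp add: n_def power_mult_distrib)
  then show ?thesis
    using x y by (auto simp: a_def intro: power2_le_imp_le)
qed

lemma hnorm_triangle:
  assumes "x \<in> carrier H" "y \<in> carrier H"
  shows "hnorm H (x \<oplus>\<^bsub>H\<^esub> y) \<le> hnorm H x + hnorm H y"
proof -
  have "Re (hinner H x y) \<le> hnorm H x * hnorm H y"
    using Cauchy_Schwarz[OF assms] complex_Re_le_cmod order_trans by blast
  then have "(hnorm H (x \<oplus>\<^bsub>H\<^esub> y))\<^sup>2 \<le> (hnorm H x + hnorm H y)\<^sup>2"
    using assms by (simp add: hnorm_add_sq power2_sum)
  then show ?thesis
    using assms by (auto intro: power2_le_imp_le)
qed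

lemma hnorm_diff_commute:
  assumes "x \<in> carrier H" "y \<in> carrier H"
  shows "hnorm H (x \<ominus>\<^bsub>H\<^esub> y) = hnorm H (y \<ominus>\<^bsub>H\<^esub> x)"
  using assms by (simp add: hnorm_def inner_simps algebra_simps)

section \<open>The metric of the norm: limits, closed sets and completeness through
  sequences\<close>

sublocale metric: Metric_space "carrier H" "hdist H"
proof
  fix x y z
  show "0 \<le> hdist H x y" "hdist H x y = hdist H y x"
    by (auto simp: hdist_def hnorm_diff_commute)
  show "hdist H x y = 0 \<longleftrightarrow> x = y" if "x \<in> carrier H" "y \<in> carrier H"
    using that by (simp add: hdist_def)
  show "hdist H x z \<le> hdist H x y + hdist H y z" 
    if "x \<in> carrier H" "y \<in> carrier H" "z \<in> carrier H"
  proof -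
    have "x \<ominus>\<^bsub>H\<^esub> z = (x \<ominus>\<^bsub>H\<^esub> y) \<oplus>\<^bsub>H\<^esub> (y \<ominus>\<^bsub>H\<^esub> z)"
      using that by (intro inner_ext) (simp_all add: inner_simps)
    then show ?thesis
      using that hnorm_triangle[of "x \<ominus>\<^bsub>H\<^esub> y" "y \<ominus>\<^bsub>H\<^esub> z"] by (simp add: hdist_def)
  qed
qed

lemma limit_iff:
  assumes "\<And>n. \<sigma> n \<in> carrier H"
  shows "limitin (htopology H) \<sigma> l sequentially \<longleftrightarrow>
    l \<in> carrier H \<and> (\<lambda>n. hnorm H (\<sigma> n \<ominus>\<^bsub>H\<^esub> l)) \<longlonglongrightarrow> 0"
  using assms by (auto simp: metric.limitin_metric_dist_null hdist_def)

text \<open>A metric topology is determined by its convergent sequences. This form, like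
  \<open>mcomplete_iff\<close>, mentions only norms of differences and can therefore be compared
  component by component in a direct sum.\<close>

lemma closed_iff:
  "closedin (htopology H) S \<longleftrightarrow> S \<subseteq> carrier H \<and>
     (\<forall>\<sigma> l. (\<forall>n. \<sigma> n \<in> S) \<and> l \<in> carrier H \<and>
        (\<lambda>n. hnorm H (\<sigma> n \<ominus>\<^bsub>H\<^esub> l)) \<longlonglongrightarrow> 0 \<longrightarrow> l \<in> S)"
proof (cases "S \<subseteq> carrier H")
  case True
  have "range \<sigma> \<subseteq> S \<and> limitin (htopology H) \<sigma> l sequentially \<longleftrightarrow>
    (\<forall>n. \<sigma> n \<in> S) \<and> l \<in> carrier H \<and> (\<lambda>n. hnorm H (\<sigma> n \<ominus>\<^bsub>H\<^esub> l)) \<longlonglongrightarrow> 0" for \<sigma> l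
    using limit_iff[of \<sigma> l] True by blast
  then show ?thesis
    unfolding metric.metric_closedin_iff_sequentially_closed by simp
qed (simp add: metric.metric_closedin_iff_sequentially_closed)

lemma closedin_limit:
  assumes "closedin (htopology H) S" "\<And>n. \<sigma> n \<in> S" "l \<in> carrier H"
    "(\<lambda>n. hnorm H (\<sigma> n \<ominus>\<^bsub>H\<^esub> l)) \<longlonglongrightarrow> 0"
  shows "l \<in> S"
  using assms unfolding closed_iff by blast

lemma mcomplete_iff:
  "metric.mcomplete \<longleftrightarrow>
     (\<forall>\<sigma>. (\<forall>n. \<sigma> n \<in> carrier H) \<and>
        (\<forall>e>0. \<exists>N. \<forall>n\<ge>N. \<forall>k\<ge>N. hnorm H (\<sigma> n \<ominus>\<^bsub>H\<^esub> \<sigma> k) < e) \<longrightarrow>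
        (\<exists>l\<in>carrier H. (\<lambda>n. hnorm H (\<sigma> n \<ominus>\<^bsub>H\<^esub> l)) \<longlonglongrightarrow> 0))"
proof -
  have Cauchy: "metric.MCauchy \<sigma> \<longleftrightarrow> (\<forall>n. \<sigma> n \<in> carrier H) \<and>
      (\<forall>e>0. \<exists>N. \<forall>n\<ge>N. \<forall>k\<ge>N. hnorm H (\<sigma> n \<ominus>\<^bsub>H\<^esub> \<sigma> k) < e)" for \<sigma>
  proof (cases "\<forall>n. \<sigma> n \<in> carrier H")
    case True
    then show ?thesis
      unfolding metric.MCauchy_def by (simp add: hdist_def image_subset_iff)
  qed (auto simp: metric.MCauchy_def)
  have lim: "(\<exists>l. limitin (htopology H) \<sigma> l sequentially) \<longleftrightarrow>
      (\<exists>l\<in>carrier H. (\<lambda>n. hnorm H (\<sigma> n \<ominus>\<^bsub>H\<^esub> l)) \<longlonglongrightarrow> 0)" if "\<forall>n. \<sigma> n \<in> carrier H" for \<sigma>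
    using that limit_iff[of \<sigma>] by auto
  show ?thesis
    unfolding metric.mcomplete_def Cauchy by (intro iff_allI imp_cong refl lim) blast
qed

section \<open>Uniqueness of projections and adjoints, and the geometry behind existence\<close>

lemma orth_proj_eqI:
  assumes W: "submodule W (scalar_ring F) H" and "f \<in> carrier H" "p \<in> W"
    and orth: "\<And>w. w \<in> W \<Longrightarrow> hinner H (f \<ominus>\<^bsub>H\<^esub> p) w = 0"
  shows "orth_proj H W f = p"
  unfolding orth_proj_def
proof (rule the_equality)
  show "p \<in> W \<and> (\<forall>w\<in>W. hinner H (f \<ominus>\<^bsub>H\<^esub> p) w = 0)"
    using assms by blast
next
  fix q assume q: "q \<in> W \<and> (\<forall>w\<in>W. hinner H (f \<ominus>\<^bsub>H\<^esub> q) w = 0)"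
  have c: "p \<in> carrier H" "q \<in> carrier H"
    using submoduleE(1)[OF W] assms q by auto
  have d: "q \<ominus>\<^bsub>H\<^esub> p \<in> W"
    using submodule_diff_closed[OF W] q assms by blast
  \<comment> \<open>\<open>q \<ominus> p\<close> is the difference of the two residuals, and both
    residuals are orthogonal to it because it lies in \<open>W\<close>.\<close>
  have "hinner H (q \<ominus>\<^bsub>H\<^esub> p) (q \<ominus>\<^bsub>H\<^esub> p)
      = hinner H (f \<ominus>\<^bsub>H\<^esub> p) (q \<ominus>\<^bsub>H\<^esub> p) - hinner H (f \<ominus>\<^bsub>H\<^esub> q) (q \<ominus>\<^bsub>H\<^esub> p)"
    using c assms by (simp add: inner_simps)
  also have "\<dots> = 0"
    using orth[OF d] q d by simp
  finally have "q \<ominus>\<^bsub>H\<^esub> p = \<zero>\<^bsub>H\<^esub>"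
    using c by (intro inner_eq_zero) auto
  then show "q = p" using c by simp
qed

text \<open>Two representing vectors have equal inner products with every \<open>f\<close>;
  conjugate symmetry moves them to the left slot, where \<open>inner_ext\<close> applies.\<close>

lemma adjoint_op_eqI:
  assumes "h \<in> carrier H" "\<And>f. f \<in> carrier H \<Longrightarrow> hinner H (K f) g = hinner H f h"
  shows "adjoint_op H K g = h"
  unfolding adjoint_op_def
proof (rule the_equality)
  show "h \<in> carrier H \<and> (\<forall>f\<in>carrier H. hinner H (K f) g = hinner H f h)"
    using assms by blast
next
  fix k assume k: "k \<in> carrier H \<and> (\<forall>f\<in>carrier H. hinner H (K f) g = hinner H f k)"
  show "k = h"
  proof (rule inner_ext)
    show "hinner H k z = hinner H h z" if "z \<in> carrier H" for z
      using that k assms inner_cnj[of k z] inner_cnj[of h z] by metis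
  qed (use k assms in auto)
qed

text \<open>First-order optimality: it turns the metric description of a closest point into the
  orthogonality that \<open>orth_proj\<close> asks for.\<close>

lemma minimizer_orthogonal:
  assumes W: "submodule W (scalar_ring F) H" and f: "f \<in> carrier H" and p: "p \<in> W"
    and min: "\<And>w. w \<in> W \<Longrightarrow> hnorm H (f \<ominus>\<^bsub>H\<^esub> p) \<le> hnorm H (f \<ominus>\<^bsub>H\<^esub> w)"
    and w: "w \<in> W"
  shows "hinner H (f \<ominus>\<^bsub>H\<^esub> p) w = 0"
proof (rule ccontr)
  assume neq: "hinner H (f \<ominus>\<^bsub>H\<^esub> p) w \<noteq> 0"
  note [simp] = subsetD[OF submoduleE(1)[OF W] p] subsetD[OF submoduleE(1)[OF W] w] f
  define a where "a = hinner H (f \<ominus>\<^bsub>H\<^esub> p) w"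
  \<comment> \<open>Moving \<open>p\<close> by \<open>t * a\<close> times \<open>w\<close> would decrease the distance to \<open>f\<close>.\<close>
  define t where "t = 1 / (1 + (hnorm H w)\<^sup>2)"
  \<comment> \<open>The summand 1 in the denominator covers the case of vanishing \<open>w\<close>
    and makes the second-order term strictly smaller than the first-order one.\<close>
  have t: "0 < t" "t * (hnorm H w)\<^sup>2 < 1"
    by (auto simp: t_def field_simps add_pos_nonneg)
  have aF: "a \<in> F" by (simp add: a_def inner_scalar)
  define c where "c = of_real t * a"
  have cF: "c \<in> F" using aF by (simp add: c_def)
  have "p \<oplus>\<^bsub>H\<^esub> c \<odot>\<^bsub>H\<^esub> w \<in> W"
    using submoduleE(4,5)[OF W] cF p w by simp
  then have "(hnorm H (f \<ominus>\<^bsub>H\<^esub> p))\<^sup>2 \<le> (hnorm H (f \<ominus>\<^bsub>H\<^esub> (p \<oplus>\<^bsub>H\<^esub> c \<odot>\<^bsub>H\<^esub> w)))\<^sup>2"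
    using min by (intro power_mono) auto
  also have "f \<ominus>\<^bsub>H\<^esub> (p \<oplus>\<^bsub>H\<^esub> c \<odot>\<^bsub>H\<^esub> w) = (f \<ominus>\<^bsub>H\<^esub> p) \<ominus>\<^bsub>H\<^esub> c \<odot>\<^bsub>H\<^esub> w"
    using cF by (intro inner_ext) (simp_all add: inner_simps)
  also have "(hnorm H \<dots>)\<^sup>2
      = (hnorm H (f \<ominus>\<^bsub>H\<^esub> p))\<^sup>2 - 2 * Re (cnj c * a) + (cmod c)\<^sup>2 * (hnorm H w)\<^sup>2"
    using cF by (simp add: hnorm_diff_sq[of "f \<ominus>\<^bsub>H\<^esub> p"] inner_smult_right hnorm_smult
        power_mult_distrib a_def)
  \<comment> \<open>The left side is twice \<open>t * (cmod a)\<^sup>2\<close>, the right side at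
    most once that amount; this forces \<open>a = 0\<close> and contradicts
    \<open>neq\<close>.\<close>
  finally have "2 * Re (cnj c * a) \<le> (cmod c)\<^sup>2 * (hnorm H w)\<^sup>2" by simp
  also have "Re (cnj c * a) = t * (cmod a)\<^sup>2"
    unfolding cmod_power2 by (simp add: c_def power2_eq_square algebra_simps)
  also have "(cmod c)\<^sup>2 * (hnorm H w)\<^sup>2 = t * (cmod a)\<^sup>2 * (t * (hnorm H w)\<^sup>2)"
    by (simp add: c_def norm_mult power_mult_distrib power2_eq_square)
  also have "\<dots> \<le> t * (cmod a)\<^sup>2 * 1"
    using t by (intro mult_left_mono) auto
  finally have "t * (cmod a)\<^sup>2 \<le> 0" by simp
  then show False using t neq by (simp add: a_def mult_le_0_iff)
qed

text \<open>The parallelogram law for \<open>f \<ominus> x\<close> and \<open>f \<ominus> y\<close>: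
  their sum is twice the difference between \<open>f\<close> and the midpoint, hence the factor 4.
  The midpoint of two vectors of a subspace stays in it, so this term can be bounded below by the
  distance to the subspace.\<close>

lemma parallelogram:
  assumes [simp]: "x \<in> carrier H" "y \<in> carrier H" "f \<in> carrier H"
  shows "(hnorm H (x \<ominus>\<^bsub>H\<^esub> y))\<^sup>2
      + 4 * (hnorm H (f \<ominus>\<^bsub>H\<^esub> of_real (1/2) \<odot>\<^bsub>H\<^esub> (x \<oplus>\<^bsub>H\<^esub> y)))\<^sup>2
    = 2 * (hnorm H (f \<ominus>\<^bsub>H\<^esub> x))\<^sup>2 + 2 * (hnorm H (f \<ominus>\<^bsub>H\<^esub> y))\<^sup>2"
proof -
  have [simp]: "complex_of_real (1/2) \<in> F" by (rule of_real_scalar)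
  show ?thesis
    using inner_cnj[of f x] inner_cnj[of f y] inner_cnj[of x y]
    by (simp add: hnorm_sq inner_simps algebra_simps del: of_real_divide)
qed

end

section \<open>Orthogonal projections and adjoints\<close>

context hilbert_space
begin

lemma Cauchy_limit:
  assumes "\<And>n. \<sigma> n \<in> carrier H"
    and "\<And>e. e > 0 \<Longrightarrow> \<exists>N. \<forall>n\<ge>N. \<forall>k\<ge>N. hnorm H (\<sigma> n \<ominus>\<^bsub>H\<^esub> \<sigma> k) < e"
  obtains l where "l \<in> carrier H" "(\<lambda>n. hnorm H (\<sigma> n \<ominus>\<^bsub>H\<^esub> l)) \<longlonglongrightarrow> 0"
  using complete assms unfolding mcomplete_iff by blast

lemma closest_point_exists:
  assumes W: "closed_subspace F H W" and f: "f \<in> carrier H"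
  shows "\<exists>p\<in>W. \<forall>w\<in>W. hnorm H (f \<ominus>\<^bsub>H\<^esub> p) \<le> hnorm H (f \<ominus>\<^bsub>H\<^esub> w)"
proof -
  have sub: "submodule W (scalar_ring F) H" and cl: "closedin (htopology H) W"
    using W by (auto simp: closed_subspace_def)
  have car: "w \<in> carrier H" if "w \<in> W" for w
    using submoduleE(1)[OF sub] that by blast
  define D where "D = (\<lambda>w. hnorm H (f \<ominus>\<^bsub>H\<^esub> w)) ` W"
  define d where "d = Inf D"
  have ne: "D \<noteq> {}" using submoduleE(2)[OF sub] by (simp add: D_def)
  have bdd: "bdd_below D" using f car by (auto simp: D_def intro!: bdd_belowI[of _ 0])
  have d_le: "d \<le> hnorm H (f \<ominus>\<^bsub>H\<^esub> w)" if "w \<in> W" for w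
    using that bdd by (auto simp: d_def D_def intro: cInf_lower)
  have d0: "0 \<le> d"
    unfolding d_def using ne f car by (intro cInf_greatest) (auto simp: D_def)
  \<comment> \<open>\<open>Suc n\<close> keeps the slack positive at \<open>n = 0\<close>; since
    \<open>inverse 0 = 0\<close>, index \<open>n\<close> itself would ask there for a point nearer
    than the infimum.\<close>
  have "\<exists>w\<in>W. hnorm H (f \<ominus>\<^bsub>H\<^esub> w) < d + inverse (real (Suc n))" for n
    using cInf_lessD[OF ne, of "d + inverse (real (Suc n))"] by (auto simp: d_def D_def)
  then obtain \<sigma> where \<sigma>: "\<And>n. \<sigma> n \<in> W" "\<And>n. hnorm H (f \<ominus>\<^bsub>H\<^esub> \<sigma> n) < d + inverse (real (Suc n))"
    by metis
  note [simp] = car[OF \<sigma>(1)] f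
  have lim: "(\<lambda>n. hnorm H (f \<ominus>\<^bsub>H\<^esub> \<sigma> n)) \<longlonglongrightarrow> d"
  proof (rule tendsto_sandwich[of "\<lambda>_. d" _ _ "\<lambda>n. d + inverse (real (Suc n))"])
    show "(\<lambda>n. d + inverse (real (Suc n))) \<longlonglongrightarrow> d"
      by (rule LIMSEQ_inverse_real_of_nat_add)
    show "\<forall>\<^sub>F n in sequentially. hnorm H (f \<ominus>\<^bsub>H\<^esub> \<sigma> n) \<le> d + inverse (real (Suc n))"
      using \<sigma>(2) by (intro always_eventually allI less_imp_le)
  qed (use d_le \<sigma> in auto)
  \<comment> \<open>The midpoint of \<open>\<sigma> n\<close> and \<open>\<sigma> k\<close> lies in
    \<open>W\<close>, so its term in \<open>parallelogram\<close> is at least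
    \<open>4 * d\<^sup>2\<close>, which is shared equally between the two excesses.\<close>
  have bound: "(hnorm H (\<sigma> n \<ominus>\<^bsub>H\<^esub> \<sigma> k))\<^sup>2
      \<le> 2 * ((hnorm H (f \<ominus>\<^bsub>H\<^esub> \<sigma> n))\<^sup>2 - d\<^sup>2) + 2 * ((hnorm H (f \<ominus>\<^bsub>H\<^esub> \<sigma> k))\<^sup>2 - d\<^sup>2)" for n k
  proof -
    have "complex_of_real (1/2) \<in> F" by (rule of_real_scalar)
    then have "of_real (1/2) \<odot>\<^bsub>H\<^esub> (\<sigma> n \<oplus>\<^bsub>H\<^esub> \<sigma> k) \<in> W"
      using submoduleE(4,5)[OF sub] \<sigma>(1) by (simp del: of_real_divide)
    then have "d\<^sup>2 \<le> (hnorm H (f \<ominus>\<^bsub>H\<^esub> of_real (1/2) \<odot>\<^bsub>H\<^esub> (\<sigma> n \<oplus>\<^bsub>H\<^esub> \<sigma> k)))\<^sup>2"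
      using d_le d0 by (intro power_mono) auto
    then show ?thesis
      using parallelogram[of "\<sigma> n" "\<sigma> k" f] by (simp del: of_real_divide)
  qed
  have "(\<lambda>n. (hnorm H (f \<ominus>\<^bsub>H\<^esub> \<sigma> n))\<^sup>2 - d\<^sup>2) \<longlonglongrightarrow> d\<^sup>2 - d\<^sup>2"
    by (intro tendsto_intros lim)
  then have lim2: "(\<lambda>n. (hnorm H (f \<ominus>\<^bsub>H\<^esub> \<sigma> n))\<^sup>2 - d\<^sup>2) \<longlonglongrightarrow> 0" by simp
  obtain p where p: "p \<in> carrier H" "(\<lambda>n. hnorm H (\<sigma> n \<ominus>\<^bsub>H\<^esub> p)) \<longlonglongrightarrow> 0"
  proof (rule Cauchy_limit[of \<sigma>])
    fix e :: real assume e: "e > 0"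
    have "\<forall>\<^sub>F n in sequentially. (hnorm H (f \<ominus>\<^bsub>H\<^esub> \<sigma> n))\<^sup>2 - d\<^sup>2 < e\<^sup>2 / 4"
      by (rule order_tendstoD(2)[OF lim2]) (use e in simp)
    then obtain N where N: "\<And>n. n \<ge> N \<Longrightarrow> (hnorm H (f \<ominus>\<^bsub>H\<^esub> \<sigma> n))\<^sup>2 - d\<^sup>2 < e\<^sup>2 / 4"
      by (auto simp: eventually_sequentially)
    \<comment> \<open>\<open>bound\<close> weights each of the two excesses by 2, so
      \<open>e\<^sup>2 / 4\<close> for each adds up to \<open>e\<^sup>2\<close>.\<close>
    have "hnorm H (\<sigma> n \<ominus>\<^bsub>H\<^esub> \<sigma> k) < e" if "n \<ge> N" "k \<ge> N" for n k
    proof (rule power2_less_imp_less)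
      show "(hnorm H (\<sigma> n \<ominus>\<^bsub>H\<^esub> \<sigma> k))\<^sup>2 < e\<^sup>2"
        using order.strict_trans1[OF bound[of n k]
            add_strict_mono[OF mult_strict_left_mono mult_strict_left_mono],
            of "e\<^sup>2 / 4" "e\<^sup>2 / 4"] N[OF that(1)] N[OF that(2)] by simp
    qed (use e in simp)
    then show "\<exists>N. \<forall>n\<ge>N. \<forall>k\<ge>N. hnorm H (\<sigma> n \<ominus>\<^bsub>H\<^esub> \<sigma> k) < e" by blast
  qed auto
  have pW: "p \<in> W" using closedin_limit[OF cl \<sigma>(1) p] .
  have "hnorm H (f \<ominus>\<^bsub>H\<^esub> p) \<le> hnorm H (f \<ominus>\<^bsub>H\<^esub> \<sigma> n) + hnorm H (\<sigma> n \<ominus>\<^bsub>H\<^esub> p)" for n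
    using metric.triangle[of f "\<sigma> n" p] p by (simp add: hdist_def)
  moreover have "(\<lambda>n. hnorm H (f \<ominus>\<^bsub>H\<^esub> \<sigma> n) + hnorm H (\<sigma> n \<ominus>\<^bsub>H\<^esub> p)) \<longlonglongrightarrow> d + 0"
    by (intro tendsto_intros lim p)
  ultimately have "hnorm H (f \<ominus>\<^bsub>H\<^esub> p) \<le> d + 0"
    by (intro LIMSEQ_le_const) auto
  then show ?thesis
    using pW d_le by force
qed

text \<open>A closest point satisfies the orthogonality condition, and by uniqueness it is the
  vector described by \<open>orth_proj\<close>.\<close>

lemma orth_proj:
  assumes W: "closed_subspace F H W" and f: "f \<in> carrier H"
  shows "orth_proj H W f \<in> W" "\<And>w. w \<in> W \<Longrightarrow> hinner H (f \<ominus>\<^bsub>H\<^esub> orth_proj H W f) w = 0"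
proof -
  obtain p where p: "p \<in> W" "\<And>w. w \<in> W \<Longrightarrow> hnorm H (f \<ominus>\<^bsub>H\<^esub> p) \<le> hnorm H (f \<ominus>\<^bsub>H\<^esub> w)"
    using closest_point_exists[OF assms] by blast
  have sub: "submodule W (scalar_ring F) H"
    using W by (simp add: closed_subspace_def)
  have orth: "hinner H (f \<ominus>\<^bsub>H\<^esub> p) w = 0" if "w \<in> W" for w
    using minimizer_orthogonal[OF sub f p that] .
  have "orth_proj H W f = p"
    using orth_proj_eqI[OF sub f p(1) orth] .
  then show "orth_proj H W f \<in> W" "\<And>w. w \<in> W \<Longrightarrow> hinner H (f \<ominus>\<^bsub>H\<^esub> orth_proj H W f) w = 0"
    using p orth by auto
qed

text \<open>The kernel \<open>N\<close> has codimension at most one: if \<open>z\<close> is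
  orthogonal to \<open>N\<close> and \<open>\<phi> z \<noteq> 0\<close>, every \<open>x\<close> is a
  multiple of \<open>z\<close> modulo \<open>N\<close>, so \<open>\<phi>\<close> and the inner
  product with \<open>z\<close> are proportional.\<close>

lemma Riesz_representation:
  assumes add: "\<And>x y. \<lbrakk>x \<in> carrier H; y \<in> carrier H\<rbrakk> \<Longrightarrow> \<phi> (x \<oplus>\<^bsub>H\<^esub> y) = \<phi> x + \<phi> y"
    and smult: "\<And>c x. \<lbrakk>c \<in> F; x \<in> carrier H\<rbrakk> \<Longrightarrow> \<phi> (c \<odot>\<^bsub>H\<^esub> x) = c * \<phi> x"
    and scalar: "\<And>x. x \<in> carrier H \<Longrightarrow> \<phi> x \<in> F"
    and bounded: "\<And>x. x \<in> carrier H \<Longrightarrow> cmod (\<phi> x) \<le> C * hnorm H x"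
  obtains h where "h \<in> carrier H" "\<And>x. x \<in> carrier H \<Longrightarrow> \<phi> x = hinner H x h"
proof -
  have zero: "\<phi> \<zero>\<^bsub>H\<^esub> = 0" using add[of "\<zero>\<^bsub>H\<^esub>" "\<zero>\<^bsub>H\<^esub>"] by simp
  have neg: "\<phi> (\<ominus>\<^bsub>H\<^esub> x) = - \<phi> x" if "x \<in> carrier H" for x
    using add[of "\<ominus>\<^bsub>H\<^esub> x" x] that zero by (simp add: M.l_neg eq_neg_iff_add_eq_0)
  have diff: "\<phi> (x \<ominus>\<^bsub>H\<^esub> y) = \<phi> x - \<phi> y" if "x \<in> carrier H" "y \<in> carrier H" for x y
    using that by (simp add: M.minus_eq add neg)
  define N where "N = {x \<in> carrier H. \<phi> x = 0}"
  have subN: "submodule N (scalar_ring F) H"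
    by (rule submoduleI) (auto simp: N_def zero neg add smult)
  have "l \<in> N"
    if \<sigma>: "\<forall>n. \<sigma> n \<in> N" and l: "l \<in> carrier H"
      and lim: "(\<lambda>n. hnorm H (\<sigma> n \<ominus>\<^bsub>H\<^esub> l)) \<longlonglongrightarrow> 0" for \<sigma> l
  proof -
    \<comment> \<open>\<open>\<phi>\<close> vanishes at \<open>\<sigma> n\<close>, so up to sign
      \<open>\<phi> l\<close> is its value at \<open>\<sigma> n \<ominus> l\<close>, which
      boundedness makes small.\<close>
    have "cmod (\<phi> l) \<le> C * hnorm H (\<sigma> n \<ominus>\<^bsub>H\<^esub> l)" for n
    proof -
      have "\<sigma> n \<in> carrier H" "\<phi> (\<sigma> n) = 0" using \<sigma> by (auto simp: N_def)
      then show ?thesis using bounded[of "\<sigma> n \<ominus>\<^bsub>H\<^esub> l"] l by (simp add: diff)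
    qed
    moreover have "(\<lambda>n. C * hnorm H (\<sigma> n \<ominus>\<^bsub>H\<^esub> l)) \<longlonglongrightarrow> C * 0"
      by (intro tendsto_intros lim)
    ultimately have "cmod (\<phi> l) \<le> C * 0"
      by (intro LIMSEQ_le_const) auto
    then show ?thesis using l by (simp add: N_def)
  qed
  then have closedN: "closed_subspace F H N"
    unfolding closed_subspace_def closed_iff using subN by (auto simp: N_def)
  show thesis
  proof (cases "\<forall>x\<in>carrier H. \<phi> x = 0")
    case True
    then show thesis using that[of "\<zero>\<^bsub>H\<^esub>"] by simp
  next
    case False
    then obtain g where g: "g \<in> carrier H" "\<phi> g \<noteq> 0" by blast
    define z where "z = g \<ominus>\<^bsub>H\<^esub> orth_proj H N g"
    have pN: "orth_proj H N g \<in> carrier H" "\<phi> (orth_proj H N g) = 0"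
      using orth_proj(1)[OF closedN g(1)] by (auto simp: N_def)
    have orth: "hinner H z w = 0" if "w \<in> N" for w
      using orth_proj(2)[OF closedN g(1) that] by (simp add: z_def)
    have z: "z \<in> carrier H" "\<phi> z \<noteq> 0" using g pN by (auto simp: z_def diff)
    then have "z \<noteq> \<zero>\<^bsub>H\<^esub>" using zero by auto
    then have n: "hnorm H z \<noteq> 0" using z by simp
    \<comment> \<open>Chosen so that \<open>hinner H z (c \<odot> z) = \<phi> z\<close>; the
      conjugate compensates for antilinearity in the second slot.\<close>
    define c where "c = cnj (\<phi> z) / of_real ((hnorm H z)\<^sup>2)"
    have c: "c \<in> F" using scalar[OF z(1)] by (simp add: c_def del: of_real_power)
    show thesis
    proof (rule that[of "c \<odot>\<^bsub>H\<^esub> z"])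
      fix x assume x: "x \<in> carrier H"
      \<comment> \<open>For real scalars this uses \<open>scalar\<close>: the values of
        \<open>\<phi>\<close> have complex type and must be known to be real. Subtracting this
        multiple of \<open>z\<close> from \<open>x\<close> makes \<open>\<phi>\<close>
        vanish.\<close>
      have q: "\<phi> x / \<phi> z \<in> F" using scalar x z by simp
      have "x \<ominus>\<^bsub>H\<^esub> (\<phi> x / \<phi> z) \<odot>\<^bsub>H\<^esub> z \<in> N"
        using x z q by (simp add: N_def diff smult)
      then have "hinner H (x \<ominus>\<^bsub>H\<^esub> (\<phi> x / \<phi> z) \<odot>\<^bsub>H\<^esub> z) z = 0"
        using orth inner_cnj[of "x \<ominus>\<^bsub>H\<^esub> (\<phi> x / \<phi> z) \<odot>\<^bsub>H\<^esub> z" z] x z q by simp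
      then have "hinner H x z = \<phi> x / \<phi> z * of_real ((hnorm H z)\<^sup>2)"
        using x z q by (simp add: inner_simps inner_self)
      then show "\<phi> x = hinner H x (c \<odot>\<^bsub>H\<^esub> z)"
        using x z c n by (simp add: inner_simps c_def)
    qed (use c z in simp)
  qed
qed

text \<open>\<open>Riesz_representation\<close> for the functional sending \<open>x\<close> to
  \<open>hinner H (K x) g\<close>, with the bound \<open>C * hnorm H g\<close> from
  \<open>Cauchy_Schwarz\<close>. Having \<open>K x\<close> in the first slot makes the functional
  linear rather than antilinear.\<close>

lemma adjoint_op:
  assumes K: "bounded_operator F H K" and g: "g \<in> carrier H"
  shows "adjoint_op H K g \<in> carrier H"
    "\<And>f. f \<in> carrier H \<Longrightarrow> hinner H (K f) g = hinner H f (adjoint_op H K g)"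
proof -
  have Kc [simp]: "K x \<in> carrier H" if "x \<in> carrier H" for x
    using K that by (auto simp: bounded_operator_def)
  have "\<exists>C. \<forall>x\<in>carrier H. hnorm H (K x) \<le> C * hnorm H x"
    using K by (simp add: bounded_operator_def)
  then obtain C where C: "\<And>x. x \<in> carrier H \<Longrightarrow> hnorm H (K x) \<le> C * hnorm H x"
    by blast
  obtain h where h: "h \<in> carrier H" "\<And>x. x \<in> carrier H \<Longrightarrow> hinner H (K x) g = hinner H x h"
  proof (rule Riesz_representation[of "\<lambda>x. hinner H (K x) g" "C * hnorm H g"])
    fix x assume x: "x \<in> carrier H"
    show "cmod (hinner H (K x) g) \<le> C * hnorm H g * hnorm H x"
      using Cauchy_Schwarz[of "K x" g] mult_right_mono[OF C[OF x], of "hnorm H g"] x g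
      by (simp add: mult_ac)
  qed (use K g in \<open>auto simp: bounded_operator_def inner_simps inner_scalar\<close>)
  have "adjoint_op H K g = h" using adjoint_op_eqI[of h K g] h by blast
  then show "adjoint_op H K g \<in> carrier H"
    "\<And>f. f \<in> carrier H \<Longrightarrow> hinner H (K f) g = hinner H f (adjoint_op H K g)"
    using h by auto
qed

end

section \<open>Direct sums\<close>

lemma direct_sum_simps [simp]:
  "carrier (direct_sum m H) = (\<Pi>\<^sub>E j\<in>{1..m}. carrier (H j))"
  "\<zero>\<^bsub>direct_sum m H\<^esub> = (\<lambda>j\<in>{1..m}. \<zero>\<^bsub>H j\<^esub>)"
  "f \<oplus>\<^bsub>direct_sum m H\<^esub> g = (\<lambda>j\<in>{1..m}. f j \<oplus>\<^bsub>H j\<^esub> g j)"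
  "c \<odot>\<^bsub>direct_sum m H\<^esub> f = (\<lambda>j\<in>{1..m}. c \<odot>\<^bsub>H j\<^esub> f j)"
  "hinner (direct_sum m H) f g = (\<Sum>j\<in>{1..m}. hinner (H j) (f j) (g j))"
  by (simp_all add: direct_sum_def)

text \<open>With \<open>1 \<le> m\<close> the facts about the scalars alone can be read off
  component 1; an empty family says nothing about \<open>F\<close>.\<close>

locale inner_space_family =
  fixes F :: "complex set" and m :: nat and H :: "nat \<Rightarrow> 'a hspace"
  assumes nonempty: "1 \<le> m"
    and inner_space: "j \<in> {1..m} \<Longrightarrow> inner_space F (H j)"
begin

lemma abelian_group_component: "j \<in> {1..m} \<Longrightarrow> abelian_group (H j)"
  using inner_space.vector_space[OF inner_space] module.axioms(2) by blast

lemma direct_sum_ext: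
  assumes "f \<in> carrier (direct_sum m H)" "g \<in> carrier (direct_sum m H)"
    "\<And>j. j \<in> {1..m} \<Longrightarrow> f j = g j"
  shows "f = g"
  using assms unfolding direct_sum_simps by (rule PiE_ext)

lemma component_closed:
  assumes "j \<in> {1..m}"
  shows "\<zero>\<^bsub>H j\<^esub> \<in> carrier (H j)"
    "\<lbrakk>x \<in> carrier (H j); y \<in> carrier (H j)\<rbrakk> \<Longrightarrow> x \<oplus>\<^bsub>H j\<^esub> y \<in> carrier (H j)"
    "x \<in> carrier (H j) \<Longrightarrow> \<ominus>\<^bsub>H j\<^esub> x \<in> carrier (H j)"
proof -
  interpret abelian_group "H j" using abelian_group_component[OF assms] .
  show "\<zero>\<^bsub>H j\<^esub> \<in> carrier (H j)"
    "\<lbrakk>x \<in> carrier (H j); y \<in> carrier (H j)\<rbrakk> \<Longrightarrow> x \<oplus>\<^bsub>H j\<^esub> y \<in> carrier (H j)"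
    "x \<in> carrier (H j) \<Longrightarrow> \<ominus>\<^bsub>H j\<^esub> x \<in> carrier (H j)" by auto
qed

lemma direct_sum_abelian_group: "abelian_group (direct_sum m H)"
proof (rule abelian_groupI, goal_cases)
  case (3 x y z)
  show ?case
  proof (simp only: direct_sum_simps, rule restrict_ext)
    fix j assume j: "j \<in> {1..m}"
    interpret abelian_group "H j" using abelian_group_component[OF j] .
    show "(\<lambda>j\<in>{1..m}. x j \<oplus>\<^bsub>H j\<^esub> y j) j \<oplus>\<^bsub>H j\<^esub> z j
      = x j \<oplus>\<^bsub>H j\<^esub> (\<lambda>j\<in>{1..m}. y j \<oplus>\<^bsub>H j\<^esub> z j) j"
      using 3 j a_assoc[of "x j" "y j" "z j"] by (auto simp: PiE_iff)
  qed
next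
  case (4 x y)
  show ?case
  proof (simp only: direct_sum_simps, rule restrict_ext)
    fix j assume j: "j \<in> {1..m}"
    interpret abelian_group "H j" using abelian_group_component[OF j] .
    show "x j \<oplus>\<^bsub>H j\<^esub> y j = y j \<oplus>\<^bsub>H j\<^esub> x j"
      using 4 j by (intro a_comm) (auto simp: PiE_iff)
  qed
next
  case (5 x)
  show ?case
  proof (rule direct_sum_ext)
    fix j assume j: "j \<in> {1..m}"
    interpret abelian_group "H j" using abelian_group_component[OF j] .
    show "(\<zero>\<^bsub>direct_sum m H\<^esub> \<oplus>\<^bsub>direct_sum m H\<^esub> x) j = x j"
      using 5 j l_zero[of "x j"] by (auto simp: PiE_iff)
  qed (use 5 component_closed in \<open>auto simp: PiE_iff\<close>)
next
  case (6 x)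
  have "(\<lambda>j\<in>{1..m}. \<ominus>\<^bsub>H j\<^esub> x j) \<oplus>\<^bsub>direct_sum m H\<^esub> x = \<zero>\<^bsub>direct_sum m H\<^esub>"
  proof (simp only: direct_sum_simps, rule restrict_ext)
    fix j assume j: "j \<in> {1..m}"
    interpret abelian_group "H j" using abelian_group_component[OF j] .
    show "(\<lambda>j\<in>{1..m}. \<ominus>\<^bsub>H j\<^esub> x j) j \<oplus>\<^bsub>H j\<^esub> x j = \<zero>\<^bsub>H j\<^esub>"
      using 6 j l_neg[of "x j"] by (auto simp: PiE_iff)
  qed
  moreover have "(\<lambda>j\<in>{1..m}. \<ominus>\<^bsub>H j\<^esub> x j) \<in> carrier (direct_sum m H)"
    using 6 component_closed(3) by (auto simp: PiE_iff)
  ultimately show ?case by blast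
qed (use component_closed in \<open>auto simp: PiE_iff\<close>)

text \<open>Negation is not a field of the record but derived from addition, so its components are
  identified by uniqueness of inverses in \<open>H j\<close>.\<close>

lemma direct_sum_neg:
  assumes f: "f \<in> carrier (direct_sum m H)" and j: "j \<in> {1..m}"
  shows "(\<ominus>\<^bsub>direct_sum m H\<^esub> f) j = \<ominus>\<^bsub>H j\<^esub> f j"
proof -
  interpret S: abelian_group "direct_sum m H" by (rule direct_sum_abelian_group)
  interpret abelian_group "H j" using abelian_group_component[OF j] .
  have "(\<ominus>\<^bsub>direct_sum m H\<^esub> f \<oplus>\<^bsub>direct_sum m H\<^esub> f) j = \<zero>\<^bsub>direct_sum m H\<^esub> j"
    using S.l_neg[OF f] by simp
  moreover have "(\<ominus>\<^bsub>direct_sum m H\<^esub> f) j \<in> carrier (H j)"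
    using S.a_inv_closed[OF f] j by (auto simp: PiE_iff)
  ultimately show ?thesis
    using minus_equality[of "(\<ominus>\<^bsub>direct_sum m H\<^esub> f) j" "f j"] f j by (auto simp: PiE_iff)
qed

lemma direct_sum_diff:
  assumes "f \<in> carrier (direct_sum m H)" "g \<in> carrier (direct_sum m H)" "j \<in> {1..m}"
  shows "(f \<ominus>\<^bsub>direct_sum m H\<^esub> g) j = f j \<ominus>\<^bsub>H j\<^esub> g j"
  using assms direct_sum_neg[of g j] by (simp add: a_minus_def del: direct_sum_simps(1))

lemma direct_sum_module: "Module.module (scalar_ring F) (direct_sum m H)"
proof -
  have vs: "Module.module (scalar_ring F) (H j)" if "j \<in> {1..m}" for j
    using inner_space.vector_space[OF inner_space[OF that]] .
  have ring: "cring (scalar_ring F)"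
    using module.axioms(1)[OF vs[of 1]] nonempty by simp
  show ?thesis
  proof (rule moduleI[OF ring direct_sum_abelian_group], goal_cases)
    case (1 a x)
    then show ?case using vs by (auto simp: PiE_iff intro!: module.smult_closed[OF vs])
  next
    case (2 a b x)
    then show ?case
      using module.smult_l_distr[OF vs, of _ a b] by (auto simp: PiE_iff intro!: restrict_ext)
  next
    case (3 a x y)
    then show ?case
      using module.smult_r_distr[OF vs, of _ a] by (auto simp: PiE_iff intro!: restrict_ext)
  next
    case (4 a b x)
    then show ?case
      using module.smult_assoc1[OF vs, of _ a b] by (auto simp: PiE_iff intro!: restrict_ext)
  next
    case (5 x)
    show ?case
    proof (rule direct_sum_ext)
      fix j assume "j \<in> {1..m}"
      then show "(\<one>\<^bsub>scalar_ring F\<^esub> \<odot>\<^bsub>direct_sum m H\<^esub> x) j = x j"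
        using 5 module.smult_one[OF vs, of j "x j"] by (auto simp: PiE_iff)
    next
      show "\<one>\<^bsub>scalar_ring F\<^esub> \<odot>\<^bsub>direct_sum m H\<^esub> x \<in> carrier (direct_sum m H)"
        using 5 module.smult_one[OF vs] by (auto simp: PiE_iff)
    qed (rule 5)
  qed
qed

lemma direct_sum_component [simp]:
  "\<lbrakk>f \<in> carrier (direct_sum m H); j \<in> {1..m}\<rbrakk> \<Longrightarrow> f j \<in> carrier (H j)"
  by auto

sublocale sum: inner_space F "direct_sum m H"
proof (rule inner_space.intro, goal_cases)
  case 1
  show ?case using inner_space.scalars[OF inner_space[of 1]] nonempty by simp
next
  case 2
  show ?case by (rule direct_sum_module)
next
  case (3 x y)
  have "hinner (H j) (x j) (y j) \<in> F" if "j \<in> {1..m}" for j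
    using inner_space.inner_scalar[OF inner_space[OF that]] 3 that direct_sum_component by blast
  moreover have "F = \<real> \<or> F = UNIV"
    using inner_space.scalars[OF inner_space[of 1]] nonempty by simp
  ultimately show ?case by (auto intro: sum_in_Reals)
next
  case (4 x y z)
  have "hinner (H j) (x j \<oplus>\<^bsub>H j\<^esub> y j) (z j) = hinner (H j) (x j) (z j) + hinner (H j) (y j) (z j)"
    if "j \<in> {1..m}" for j
    using inner_space.inner_add_left[OF inner_space[OF that]] 4 that direct_sum_component by blast
  then show ?case by (simp flip: sum.distrib)
next
  case (5 c x y)
  have "hinner (H j) (c \<odot>\<^bsub>H j\<^esub> x j) (y j) = c * hinner (H j) (x j) (y j)" if "j \<in> {1..m}" for j
    using inner_space.inner_smult_left[OF inner_space[OF that]] 5 that direct_sum_component by blast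
  then show ?case by (simp add: sum_distrib_left)
next
  case (6 x y)
  have "hinner (H j) (x j) (y j) = cnj (hinner (H j) (y j) (x j))" if "j \<in> {1..m}" for j
    using inner_space.inner_cnj[OF inner_space[OF that]] 6 that direct_sum_component by blast
  then show ?case by simp
next
  case (7 x)
  have "0 \<le> Re (hinner (H j) (x j) (x j))" if "j \<in> {1..m}" for j
    using inner_space.inner_nonneg[OF inner_space[OF that]] 7 that direct_sum_component by blast
  then show ?case by (auto intro!: sum_nonneg)
next
  case (8 x)
  have nonneg: "0 \<le> Re (hinner (H j) (x j) (x j))" if "j \<in> {1..m}" for j
    using inner_space.inner_nonneg[OF inner_space[OF that]] 8 that direct_sum_component by blast
  \<comment> \<open>Definiteness: a vanishing sum of nonnegative reals vanishes term by term, and by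
    \<open>inner_self\<close> the real parts determine the inner products.\<close>
  have "(\<Sum>j\<in>{1..m}. Re (hinner (H j) (x j) (x j))) = Re 0"
    using 8(2) by (simp flip: Re_sum)
  then have Re0: "Re (hinner (H j) (x j) (x j)) = 0" if "j \<in> {1..m}" for j
    using sum_nonneg_0[OF _ nonneg _ that] by simp
  show ?case
  proof (rule direct_sum_ext)
    fix j assume j: "j \<in> {1..m}"
    interpret inner_space F "H j" using inner_space[OF j] .
    have x: "x j \<in> carrier (H j)" using 8 j direct_sum_component by blast
    then have "hinner (H j) (x j) (x j) = 0"
      using inner_self[OF x] hnorm_sq[OF x] Re0[OF j] by simp
    then show "x j = \<zero>\<^bsub>direct_sum m H\<^esub> j"
      using inner_eq_zero[OF x] j by simp
  next
    show "\<zero>\<^bsub>direct_sum m H\<^esub> \<in> carrier (direct_sum m H)"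
      using module.axioms(2)[OF direct_sum_module] abelian_group.axioms(1)
        abelian_monoid.zero_closed by blast
  qed (use 8 in auto)
qed

text \<open>Pythagoras in the orthogonal sum; operator bounds, convergence and frame bounds on the
  sum are reduced to the components through it.\<close>

lemma hnorm_direct_sum:
  assumes "f \<in> carrier (direct_sum m H)"
  shows "(hnorm (direct_sum m H) f)\<^sup>2 = (\<Sum>j\<in>{1..m}. (hnorm (H j) (f j))\<^sup>2)"
proof -
  have "(hnorm (H j) (f j))\<^sup>2 = Re (hinner (H j) (f j) (f j))" if "j \<in> {1..m}" for j
    using inner_space.hnorm_sq[OF inner_space[OF that]] assms that direct_sum_component by blast
  then show ?thesis using sum.hnorm_sq[OF assms] by simp
qed

lemma hnorm_component_nonneg:
  "\<lbrakk>f \<in> carrier (direct_sum m H); j \<in> {1..m}\<rbrakk> \<Longrightarrow> 0 \<le> hnorm (H j) (f j)"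
  using inner_space.hnorm_nonneg[OF inner_space] direct_sum_component by blast

lemma hnorm_component_le:
  assumes f: "f \<in> carrier (direct_sum m H)" and j: "j \<in> {1..m}"
  shows "hnorm (H j) (f j) \<le> hnorm (direct_sum m H) f"
proof (rule power2_le_imp_le)
  show "(hnorm (H j) (f j))\<^sup>2 \<le> (hnorm (direct_sum m H) f)\<^sup>2"
    unfolding hnorm_direct_sum[OF f] using j by (intro member_le_sum) auto
qed (use sum.hnorm_nonneg[OF f] in simp)

text \<open>Each component norm is dominated by the norm of the sum; conversely the norm of the sum
  is the square root of a finite sum of squares and depends continuously on the component
  norms.\<close>

lemma direct_sum_tendsto_iff:
  assumes \<sigma>: "\<And>n. \<sigma> n \<in> carrier (direct_sum m H)" and l: "l \<in> carrier (direct_sum m H)"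
  shows "(\<lambda>n. hnorm (direct_sum m H) (\<sigma> n \<ominus>\<^bsub>direct_sum m H\<^esub> l)) \<longlonglongrightarrow> 0 \<longleftrightarrow>
    (\<forall>j\<in>{1..m}. (\<lambda>n. hnorm (H j) (\<sigma> n j \<ominus>\<^bsub>H j\<^esub> l j)) \<longlonglongrightarrow> 0)"
    (is "?L \<longleftrightarrow> ?R")
proof
  have d: "\<sigma> n \<ominus>\<^bsub>direct_sum m H\<^esub> l \<in> carrier (direct_sum m H)" for n
    using \<sigma> l by (rule sum.M.minus_closed)
  {
    assume L: ?L
    show ?R
    proof
      fix j assume j: "j \<in> {1..m}"
      show "(\<lambda>n. hnorm (H j) (\<sigma> n j \<ominus>\<^bsub>H j\<^esub> l j)) \<longlonglongrightarrow> 0"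
      proof (rule tendsto_sandwich[OF _ _ tendsto_const L])
        show "\<forall>\<^sub>F n in sequentially. 0 \<le> hnorm (H j) (\<sigma> n j \<ominus>\<^bsub>H j\<^esub> l j)"
          using hnorm_component_nonneg[OF d j] direct_sum_diff[OF \<sigma> l j] by simp
        show "\<forall>\<^sub>F n in sequentially. hnorm (H j) (\<sigma> n j \<ominus>\<^bsub>H j\<^esub> l j)
            \<le> hnorm (direct_sum m H) (\<sigma> n \<ominus>\<^bsub>direct_sum m H\<^esub> l)"
          using hnorm_component_le[OF d j] direct_sum_diff[OF \<sigma> l j] by simp
      qed
    qed
  next
    assume R: ?R
    have "hnorm (direct_sum m H) (\<sigma> n \<ominus>\<^bsub>direct_sum m H\<^esub> l)
        = sqrt (\<Sum>j\<in>{1..m}. (hnorm (H j) (\<sigma> n j \<ominus>\<^bsub>H j\<^esub> l j))\<^sup>2)" for n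
      using hnorm_direct_sum[OF d, of n] sum.hnorm_nonneg[OF d, of n] direct_sum_diff[OF \<sigma> l]
      by (metis (no_types, lifting) real_sqrt_unique sum.cong)
    moreover have "(\<lambda>n. sqrt (\<Sum>j\<in>{1..m}. (hnorm (H j) (\<sigma> n j \<ominus>\<^bsub>H j\<^esub> l j))\<^sup>2))
        \<longlonglongrightarrow> sqrt (\<Sum>j\<in>{1..m}. 0\<^sup>2)"
      using R by (intro tendsto_intros) auto
    ultimately show ?L by simp
  }
qed

lemma direct_sum_subspace_closed:
  assumes W: "\<And>j. j \<in> {1..m} \<Longrightarrow> closed_subspace F (H j) (W j)"
  shows "closed_subspace F (direct_sum m H) (direct_sum_subspace m W)"
proof -
  have sub: "submodule (W j) (scalar_ring F) (H j)" if "j \<in> {1..m}" for j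
    using W[OF that] by (simp add: closed_subspace_def)
  note mod = inner_space.vector_space[OF inner_space]
  note closed = module.submoduleE[OF mod sub] module.submodule_zero_closed[OF mod sub]
  have carrier: "direct_sum_subspace m W \<subseteq> carrier (direct_sum m H)"
    using subsetD[OF closed(1)] by (auto simp: direct_sum_subspace_def PiE_iff)
  have "submodule (direct_sum_subspace m W) (scalar_ring F) (direct_sum m H)"
  proof (rule sum.submoduleI, goal_cases)
    case (3 f)
    then have f: "f \<in> carrier (direct_sum m H)" using carrier by blast
    show ?case
      unfolding direct_sum_subspace_def
    proof (rule PiE_I)
      show "(\<ominus>\<^bsub>direct_sum m H\<^esub> f) j \<in> W j" if "j \<in> {1..m}" for j
        using 3 closed(3)[OF that that] direct_sum_neg[OF f that] that
        by (auto simp: direct_sum_subspace_def PiE_iff)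
      \<comment> \<open>Outside the index range the value is fixed by membership in the carrier,
        whose elements are extensional.\<close>
      show "(\<ominus>\<^bsub>direct_sum m H\<^esub> f) j = undefined" if "j \<notin> {1..m}" for j
        using sum.M.a_inv_closed[OF f] that by (auto simp: PiE_iff extensional_def)
    qed
  qed (use carrier closed(4-) in \<open>auto simp: direct_sum_subspace_def PiE_iff\<close>)
  moreover have "closedin (htopology (direct_sum m H)) (direct_sum_subspace m W)"
    unfolding sum.closed_iff
  proof (intro conjI allI impI carrier)
    fix \<sigma> l
    assume "(\<forall>n. \<sigma> n \<in> direct_sum_subspace m W) \<and> l \<in> carrier (direct_sum m H) \<and>
      (\<lambda>n. hnorm (direct_sum m H) (\<sigma> n \<ominus>\<^bsub>direct_sum m H\<^esub> l)) \<longlonglongrightarrow> 0"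
    then have \<sigma>: "\<And>n. \<sigma> n \<in> direct_sum_subspace m W" and l: "l \<in> carrier (direct_sum m H)"
      and lim: "(\<lambda>n. hnorm (direct_sum m H) (\<sigma> n \<ominus>\<^bsub>direct_sum m H\<^esub> l)) \<longlonglongrightarrow> 0" by auto
    have "l j \<in> W j" if j: "j \<in> {1..m}" for j
    proof -
      have \<sigma>_carrier: "\<sigma> n \<in> carrier (direct_sum m H)" for n
        using carrier \<sigma> by (rule subsetD)
      have closed: "closedin (htopology (H j)) (W j)"
        using W[OF j] by (simp add: closed_subspace_def)
      show ?thesis
      proof (rule inner_space.closedin_limit[OF inner_space[OF j] closed])
        show "(\<lambda>n. hnorm (H j) (\<sigma> n j \<ominus>\<^bsub>H j\<^esub> l j)) \<longlonglongrightarrow> 0"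
          using lim j unfolding direct_sum_tendsto_iff[OF \<sigma>_carrier l] by (rule bspec)
        show "\<sigma> n j \<in> W j" for n
          using \<sigma>[of n] j by (auto simp: direct_sum_subspace_def PiE_iff)
      qed (rule direct_sum_component[OF l j])
    qed
    then show "l \<in> direct_sum_subspace m W"
      using l by (auto simp: direct_sum_subspace_def PiE_iff)
  qed
  ultimately show ?thesis by (simp add: closed_subspace_def)
qed

lemma direct_sum_op_closed:
  assumes "\<And>j. j \<in> {1..m} \<Longrightarrow> K j \<in> carrier (H j) \<rightarrow> carrier (H j)"
    and "f \<in> carrier (direct_sum m H)"
  shows "direct_sum_op m K f \<in> carrier (direct_sum m H)"
  using assms by (auto simp: direct_sum_op_def PiE_iff Pi_iff)

lemma direct_sum_op_bounded:
  assumes K: "\<And>j. j \<in> {1..m} \<Longrightarrow> bounded_operator F (H j) (K j)"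
  shows "bounded_operator F (direct_sum m H) (direct_sum_op m K)"
proof -
  have Kc: "K j \<in> carrier (H j) \<rightarrow> carrier (H j)" if "j \<in> {1..m}" for j
    using K[OF that] by (simp add: bounded_operator_def)
  have "\<forall>j\<in>{1..m}. \<exists>C. \<forall>x\<in>carrier (H j). hnorm (H j) (K j x) \<le> C * hnorm (H j) x"
    using K by (simp add: bounded_operator_def)
  then obtain C where C: "\<And>j x. \<lbrakk>j \<in> {1..m}; x \<in> carrier (H j)\<rbrakk> \<Longrightarrow>
      hnorm (H j) (K j x) \<le> C j * hnorm (H j) x"
    by metis
  \<comment> \<open>A common bound for all \<open>C j\<close>; the absolute values make it
    nonnegative and dominating even if some \<open>C j\<close> is negative.\<close>
  define B where "B = (\<Sum>j\<in>{1..m}. \<bar>C j\<bar>)"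
  have CB: "C j \<le> B" if "j \<in> {1..m}" for j
    using member_le_sum[of j "{1..m}" "\<lambda>j. \<bar>C j\<bar>"] that by (auto simp: B_def)
  have B0: "0 \<le> B" by (simp add: B_def sum_nonneg)
  have bound: "hnorm (direct_sum m H) (direct_sum_op m K f) \<le> B * hnorm (direct_sum m H) f"
    if f: "f \<in> carrier (direct_sum m H)" for f
  proof (rule power2_le_imp_le)
    note Kf = direct_sum_op_closed[of K, OF Kc f]
    have "(hnorm (direct_sum m H) (direct_sum_op m K f))\<^sup>2
        = (\<Sum>j\<in>{1..m}. (hnorm (H j) (direct_sum_op m K f j))\<^sup>2)"
      using hnorm_direct_sum[OF Kf] .
    also have "\<dots> \<le> (\<Sum>j\<in>{1..m}. (B * hnorm (H j) (f j))\<^sup>2)"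
    proof (intro sum_mono power_mono)
      fix j assume j: "j \<in> {1..m}"
      have "hnorm (H j) (direct_sum_op m K f j) \<le> C j * hnorm (H j) (f j)"
        using C[OF j direct_sum_component[OF f j]] j by (simp add: direct_sum_op_def)
      also have "\<dots> \<le> B * hnorm (H j) (f j)"
        using CB[OF j] hnorm_component_nonneg[OF f j] by (rule mult_right_mono)
      finally show "hnorm (H j) (direct_sum_op m K f j) \<le> B * hnorm (H j) (f j)" .
      show "0 \<le> hnorm (H j) (direct_sum_op m K f j)"
        using hnorm_component_nonneg[OF Kf j] .
    qed
    also have "\<dots> = (B * hnorm (direct_sum m H) f)\<^sup>2"
      by (simp add: power_mult_distrib hnorm_direct_sum[OF f] sum_distrib_left)
    finally show "(hnorm (direct_sum m H) (direct_sum_op m K f))\<^sup>2 \<le> (B * hnorm (direct_sum m H) f)\<^sup>2" .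
  qed (use B0 sum.hnorm_nonneg[OF f] in simp)
  have add: "K j (x j \<oplus>\<^bsub>H j\<^esub> y j) = K j (x j) \<oplus>\<^bsub>H j\<^esub> K j (y j)"
    if "x \<in> carrier (direct_sum m H)" "y \<in> carrier (direct_sum m H)" "j \<in> {1..m}" for x y j
    using K that direct_sum_component unfolding bounded_operator_def by blast
  have smult: "K j (c \<odot>\<^bsub>H j\<^esub> x j) = c \<odot>\<^bsub>H j\<^esub> K j (x j)"
    if "c \<in> F" "x \<in> carrier (direct_sum m H)" "j \<in> {1..m}" for c x j
    using K that direct_sum_component unfolding bounded_operator_def by blast
  show ?thesis
    unfolding bounded_operator_def
  proof (intro conjI ballI exI)
    show "direct_sum_op m K \<in> carrier (direct_sum m H) \<rightarrow> carrier (direct_sum m H)"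
      using direct_sum_op_closed[of K, OF Kc] by blast
  next
    fix x y assume "x \<in> carrier (direct_sum m H)" "y \<in> carrier (direct_sum m H)"
    then show "direct_sum_op m K (x \<oplus>\<^bsub>direct_sum m H\<^esub> y)
        = direct_sum_op m K x \<oplus>\<^bsub>direct_sum m H\<^esub> direct_sum_op m K y"
      using add[of x y] by (auto simp: direct_sum_op_def intro!: restrict_ext)
  next
    fix c x assume "c \<in> F" "x \<in> carrier (direct_sum m H)"
    then show "direct_sum_op m K (c \<odot>\<^bsub>direct_sum m H\<^esub> x)
        = c \<odot>\<^bsub>direct_sum m H\<^esub> direct_sum_op m K x"
      using smult[of c x] by (auto simp: direct_sum_op_def intro!: restrict_ext)
  qed (rule bound)
qed

end

section \<open>Completeness of the direct sum, and its projections and adjoints\<close>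

locale hilbert_space_family =
  fixes F :: "complex set" and m :: nat and H :: "nat \<Rightarrow> 'a hspace"
  assumes nonempty: "1 \<le> m"
    and hilbert_space: "j \<in> {1..m} \<Longrightarrow> hilbert_space F (H j)"

sublocale hilbert_space_family \<subseteq> inner_space_family
proof (rule inner_space_family.intro)
  fix j assume "j \<in> {1..m}"
  then interpret hilbert_space F "H j" by (rule hilbert_space)
  show "inner_space F (H j)" by (rule inner_space_axioms)
qed (rule nonempty)

context hilbert_space_family
begin

sublocale sum: hilbert_space F "direct_sum m H"
proof (intro hilbert_space.intro)
  show "sum.metric.mcomplete"
    unfolding sum.mcomplete_iff
  proof (intro allI impI)
    fix \<sigma> :: "nat \<Rightarrow> nat \<Rightarrow> 'a"
    assume *: "(\<forall>n. \<sigma> n \<in> carrier (direct_sum m H)) \<and>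
      (\<forall>e>0. \<exists>N. \<forall>n\<ge>N. \<forall>k\<ge>N. hnorm (direct_sum m H) (\<sigma> n \<ominus>\<^bsub>direct_sum m H\<^esub> \<sigma> k) < e)"
    then have \<sigma>: "\<And>n. \<sigma> n \<in> carrier (direct_sum m H)" by blast
    have "\<exists>l\<in>carrier (H j). (\<lambda>n. hnorm (H j) (\<sigma> n j \<ominus>\<^bsub>H j\<^esub> l)) \<longlonglongrightarrow> 0" if j: "j \<in> {1..m}" for j
    proof -
      interpret hilbert_space F "H j" using hilbert_space[OF j] .
      have le: "hnorm (H j) (\<sigma> n j \<ominus>\<^bsub>H j\<^esub> \<sigma> k j)
          \<le> hnorm (direct_sum m H) (\<sigma> n \<ominus>\<^bsub>direct_sum m H\<^esub> \<sigma> k)" for n k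
        using hnorm_component_le[OF sum.M.minus_closed[OF \<sigma> \<sigma>] j] direct_sum_diff[OF \<sigma> \<sigma> j]
        by simp
      show ?thesis
      proof (rule Cauchy_limit[of "\<lambda>n. \<sigma> n j"])
        show "\<sigma> n j \<in> carrier (H j)" for n using direct_sum_component[OF \<sigma> j] .
        show "\<exists>N. \<forall>n\<ge>N. \<forall>k\<ge>N. hnorm (H j) (\<sigma> n j \<ominus>\<^bsub>H j\<^esub> \<sigma> k j) < e" if "e > 0" for e
          using * that le by (meson order_le_less_trans)
      qed blast
    qed
    then obtain l where l: "\<And>j. j \<in> {1..m} \<Longrightarrow> l j \<in> carrier (H j)"
      "\<And>j. j \<in> {1..m} \<Longrightarrow> (\<lambda>n. hnorm (H j) (\<sigma> n j \<ominus>\<^bsub>H j\<^esub> l j)) \<longlonglongrightarrow> 0"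
      by metis
    \<comment> \<open>The chosen \<open>l\<close> is arbitrary outside the index range, whereas the
      carrier demands \<open>undefined\<close> there.\<close>
    have lc: "restrict l {1..m} \<in> carrier (direct_sum m H)" using l by simp
    show "\<exists>l\<in>carrier (direct_sum m H).
        (\<lambda>n. hnorm (direct_sum m H) (\<sigma> n \<ominus>\<^bsub>direct_sum m H\<^esub> l)) \<longlonglongrightarrow> 0"
      using lc direct_sum_tendsto_iff[OF \<sigma> lc] l by (intro bexI[OF _ lc]) simp
  qed
qed (fact sum.scalars sum.vector_space sum.inner_scalar sum.inner_add_left
    sum.inner_smult_left sum.inner_cnj sum.inner_nonneg sum.inner_eq_zero)+

text \<open>A vector of the product subspace has its components in the \<open>W j\<close>, so its
  inner product with the residual is a sum of zeros and the componentwise projection passes the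
  criterion of \<open>orth_proj_eqI\<close>.\<close>

lemma orth_proj_direct_sum:
  assumes W: "\<And>j. j \<in> {1..m} \<Longrightarrow> closed_subspace F (H j) (W j)"
    and f: "f \<in> carrier (direct_sum m H)"
  shows "orth_proj (direct_sum m H) (direct_sum_subspace m W) f
    = (\<lambda>j\<in>{1..m}. orth_proj (H j) (W j) (f j))"
proof -
  define p where "p = (\<lambda>j\<in>{1..m}. orth_proj (H j) (W j) (f j))"
  have pj: "p j = orth_proj (H j) (W j) (f j)" if "j \<in> {1..m}" for j
    using that by (simp add: p_def)
  have sub: "submodule (direct_sum_subspace m W) (scalar_ring F) (direct_sum m H)"
    using direct_sum_subspace_closed[of W] W by (simp add: closed_subspace_def)
  have pW: "p \<in> direct_sum_subspace m W"
    using hilbert_space.orth_proj(1)[OF hilbert_space W] direct_sum_component[OF f]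
    by (auto simp: direct_sum_subspace_def p_def)
  have p: "p \<in> carrier (direct_sum m H)"
    using pW sum.submoduleE(1)[OF sub] by blast
  have "hinner (direct_sum m H) (f \<ominus>\<^bsub>direct_sum m H\<^esub> p) w = 0"
    if "w \<in> direct_sum_subspace m W" for w
  proof -
    have "hinner (H j) ((f \<ominus>\<^bsub>direct_sum m H\<^esub> p) j) (w j) = 0" if j: "j \<in> {1..m}" for j
    proof -
      have "w j \<in> W j"
        using \<open>w \<in> direct_sum_subspace m W\<close> j by (auto simp: direct_sum_subspace_def)
      then show ?thesis
        using hilbert_space.orth_proj(2)[OF hilbert_space[OF j] W[OF j]] direct_sum_component[OF f j]
        by (simp only: direct_sum_diff[OF f p j] pj[OF j])
    qed
    then show ?thesis by simp
  qed
  then show ?thesis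
    using sum.orth_proj_eqI[OF sub f pW] by (simp add: p_def)
qed

text \<open>Adding the duality identities of the components gives the one required by
  \<open>adjoint_op_eqI\<close>.\<close>

lemma adjoint_op_direct_sum:
  assumes K: "\<And>j. j \<in> {1..m} \<Longrightarrow> bounded_operator F (H j) (K j)"
    and g: "g \<in> carrier (direct_sum m H)"
  shows "adjoint_op (direct_sum m H) (direct_sum_op m K) g
    = (\<lambda>j\<in>{1..m}. adjoint_op (H j) (K j) (g j))"
proof (rule sum.adjoint_op_eqI)
  show "(\<lambda>j\<in>{1..m}. adjoint_op (H j) (K j) (g j)) \<in> carrier (direct_sum m H)"
    using hilbert_space.adjoint_op(1)[OF hilbert_space K] direct_sum_component[OF g] by simp
  fix f assume f: "f \<in> carrier (direct_sum m H)"
  have "hinner (H j) (K j (f j)) (g j) = hinner (H j) (f j) (adjoint_op (H j) (K j) (g j))"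
    if j: "j \<in> {1..m}" for j
    using hilbert_space.adjoint_op(2)[OF hilbert_space K, OF j j]
      direct_sum_component[OF f j] direct_sum_component[OF g j] by blast
  then show "hinner (direct_sum m H) (direct_sum_op m K f) g
      = hinner (direct_sum m H) f (\<lambda>j\<in>{1..m}. adjoint_op (H j) (K j) (g j))"
    by (simp add: direct_sum_op_def)
qed

end

text \<open>Exchanges the series over \<open>I\<close> with the sum over components while carrying
  convergence along. For infinite \<open>J\<close> both inner sums are \<open>0\<close> by
  convention, and the claim is that the zero family has sum \<open>0\<close>.\<close>

lemma has_sum_finite_sum:
  fixes f :: "'j \<Rightarrow> 'i \<Rightarrow> 'b::topological_comm_monoid_add"
  assumes "\<And>j. j \<in> J \<Longrightarrow> (f j has_sum s j) I"
  shows "((\<lambda>i. \<Sum>j\<in>J. f j i) has_sum (\<Sum>j\<in>J. s j)) I"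
  using assms by (induction J rule: infinite_finite_induct) (auto intro: has_sum_add)

section \<open>The frame inequalities on the direct sum\<close>

theorem theorem4p9:
  fixes F :: "complex set" and m :: nat and H :: "nat \<Rightarrow> 'a hspace"
    and K :: "nat \<Rightarrow> 'a \<Rightarrow> 'a" and I :: "'i set"
    and W :: "'i \<Rightarrow> nat \<Rightarrow> 'a set" and v :: "'i \<Rightarrow> real"
  assumes "1 \<le> m"
    and "countable I"
    and "\<forall>j\<in>{1..m}. hilbert_space F (H j) \<and> separable_space (htopology (H j))"
    and "\<forall>j\<in>{1..m}. bounded_operator F (H j) (K j)"
    and "\<forall>j\<in>{1..m}. K_fusion_frame F (H j) (K j) I (\<lambda>i. W i j) v"
    and "\<forall>i\<in>I. \<forall>j\<in>{1..m}. \<forall>k\<in>{1..m}. j \<noteq> k \<longrightarrow>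
           direct_sum_embed m H j ` W i j \<inter> direct_sum_embed m H k ` W i k
             = {\<zero>\<^bsub>direct_sum m H\<^esub>}"
  shows "K_fusion_frame F (direct_sum m H) (direct_sum_op m K) I
           (\<lambda>i. direct_sum_subspace m (W i)) v"
proof -
  interpret hilbert_space_family F m H
    using assms(1,3) by (intro hilbert_space_family.intro) auto
  let ?S = "direct_sum m H"
  have K: "bounded_operator F (H j) (K j)" if "j \<in> {1..m}" for j
    using assms(4) that by blast
  have W: "closed_subspace F (H j) (W i j)" if "i \<in> I" "j \<in> {1..m}" for i j
    using assms(5) that by (auto simp: K_fusion_frame_def)
  have v: "0 < v i" if "i \<in> I" for i
    using assms(1,5) that by (auto simp: K_fusion_frame_def)
  define T where "T j x i = (v i)\<^sup>2 * (hnorm (H j) (orth_proj (H j) (W i j) x))\<^sup>2" for j x i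
  \<comment> \<open>The frame condition of one component with explicit bounds, so that bounds can be
    chosen for all \<open>j\<close> simultaneously.\<close>
  define P where "P j A B \<longleftrightarrow> (\<forall>x\<in>carrier (H j). T j x summable_on I \<and>
      A * (hnorm (H j) (adjoint_op (H j) (K j) x))\<^sup>2 \<le> infsum (T j x) I \<and>
      infsum (T j x) I \<le> B * (hnorm (H j) x)\<^sup>2)" for j and A B :: real
  have "\<forall>j\<in>{1..m}. \<exists>A B. 0 < A \<and> 0 < B \<and> P j A B"
    using assms(5) unfolding K_fusion_frame_def T_def P_def by blast
  then obtain A B where AB: "\<And>j. j \<in> {1..m} \<Longrightarrow> 0 < A j" "\<And>j. j \<in> {1..m} \<Longrightarrow> 0 < B j"
    "\<And>j. j \<in> {1..m} \<Longrightarrow> P j (A j) (B j)"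
    by metis
  have T: "T j x summable_on I"
    and lower: "A j * (hnorm (H j) (adjoint_op (H j) (K j) x))\<^sup>2 \<le> infsum (T j x) I"
    and upper: "infsum (T j x) I \<le> B j * (hnorm (H j) x)\<^sup>2"
    if "j \<in> {1..m}" "x \<in> carrier (H j)" for j x
    using AB(3)[OF that(1)] that(2) by (simp_all add: P_def)
  define a where "a = Min (A ` {1..m})"
  define b where "b = Max (B ` {1..m})"
  have a: "a \<le> A j" and b: "B j \<le> b" if "j \<in> {1..m}" for j
    using that by (auto simp: a_def b_def)
  \<comment> \<open>The index set is finite and nonempty, so the minimum is attained at some
    positive \<open>A j\<close>; positivity of \<open>b\<close> follows from
    \<open>B 1 \<le> b\<close>.\<close>
  have a0: "0 < a" using AB assms(1) by (auto simp: a_def)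
  have b0: "0 < b" using AB(2)[of 1] b[of 1] assms(1) by fastforce
  have frame: "(\<lambda>i. (v i)\<^sup>2 * (hnorm ?S (orth_proj ?S (direct_sum_subspace m (W i)) f))\<^sup>2) summable_on I \<and>
      a * (hnorm ?S (adjoint_op ?S (direct_sum_op m K) f))\<^sup>2
        \<le> (\<Sum>\<^sub>\<infinity>i\<in>I. (v i)\<^sup>2 * (hnorm ?S (orth_proj ?S (direct_sum_subspace m (W i)) f))\<^sup>2) \<and>
      (\<Sum>\<^sub>\<infinity>i\<in>I. (v i)\<^sup>2 * (hnorm ?S (orth_proj ?S (direct_sum_subspace m (W i)) f))\<^sup>2)
        \<le> b * (hnorm ?S f)\<^sup>2" (is "?t summable_on I \<and> ?lo \<and> ?hi")
    if f: "f \<in> carrier ?S" for f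
  proof -
    have fj: "f j \<in> carrier (H j)" if "j \<in> {1..m}" for j
      using direct_sum_component[OF f that] .
    \<comment> \<open>Pythagoras for the componentwise projection; the weight \<open>v i\<close>
      does not depend on \<open>j\<close> and distributes over the finite sum.\<close>
    have t: "?t i = (\<Sum>j\<in>{1..m}. T j (f j) i)" if i: "i \<in> I" for i
    proof -
      have "orth_proj ?S (direct_sum_subspace m (W i)) f
          = (\<lambda>j\<in>{1..m}. orth_proj (H j) (W i j) (f j))"
        using orth_proj_direct_sum[of "W i"] W i f by blast
      moreover from this have "(\<lambda>j\<in>{1..m}. orth_proj (H j) (W i j) (f j)) \<in> carrier ?S"
        using sum.orth_proj(1)[OF direct_sum_subspace_closed[of "W i"] f] W[OF i]
          sum.submoduleE(1) direct_sum_subspace_closed[of "W i"]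
        unfolding closed_subspace_def by fastforce
      ultimately show ?thesis
        using hnorm_direct_sum by (simp add: T_def sum_distrib_left)
    qed
    have "((\<lambda>i. \<Sum>j\<in>{1..m}. T j (f j) i) has_sum (\<Sum>j\<in>{1..m}. infsum (T j (f j)) I)) I"
      using T fj by (intro has_sum_finite_sum has_sum_infsum) auto
    then have "(?t has_sum (\<Sum>j\<in>{1..m}. infsum (T j (f j)) I)) I"
      by (simp only: has_sum_cong[OF t])
    then have summable: "?t summable_on I"
      and total: "infsum ?t I = (\<Sum>j\<in>{1..m}. infsum (T j (f j)) I)"
      by (auto simp: has_sum_imp_summable infsumI)
    have adj: "adjoint_op ?S (direct_sum_op m K) f = (\<lambda>j\<in>{1..m}. adjoint_op (H j) (K j) (f j))"
      using adjoint_op_direct_sum[of K, OF K f] .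
    have adjc: "adjoint_op ?S (direct_sum_op m K) f \<in> carrier ?S"
      using sum.adjoint_op(1)[OF direct_sum_op_bounded[of K, OF K] f] .
    \<comment> \<open>Pythagoras again, now for the componentwise adjoint; each term is then
      compared with the lower bound of its own component through \<open>a \<le> A j\<close>.\<close>
    have "a * (hnorm ?S (adjoint_op ?S (direct_sum_op m K) f))\<^sup>2
        = (\<Sum>j\<in>{1..m}. a * (hnorm (H j) (adjoint_op (H j) (K j) (f j)))\<^sup>2)"
      unfolding hnorm_direct_sum[OF adjc] by (simp add: adj sum_distrib_left)
    also have "\<dots> \<le> (\<Sum>j\<in>{1..m}. infsum (T j (f j)) I)"
    proof (rule sum_mono)
      fix j assume j: "j \<in> {1..m}"
      show "a * (hnorm (H j) (adjoint_op (H j) (K j) (f j)))\<^sup>2 \<le> infsum (T j (f j)) I"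
        using mult_right_mono[OF a[OF j]] lower[OF j fj[OF j]] zero_le_power2 order_trans by blast
    qed
    finally have lo: ?lo by (simp only: total)
    have "(\<Sum>j\<in>{1..m}. infsum (T j (f j)) I) \<le> (\<Sum>j\<in>{1..m}. b * (hnorm (H j) (f j))\<^sup>2)"
    proof (rule sum_mono)
      fix j assume j: "j \<in> {1..m}"
      show "infsum (T j (f j)) I \<le> b * (hnorm (H j) (f j))\<^sup>2"
        using mult_right_mono[OF b[OF j]] upper[OF j fj[OF j]] zero_le_power2 order_trans by blast
    qed
    also have "\<dots> = b * (hnorm ?S f)\<^sup>2"
      unfolding hnorm_direct_sum[OF f] by (simp add: sum_distrib_left)
    finally have hi: ?hi by (simp only: total)
    show ?thesis using summable lo hi by blast
  qed
  show ?thesis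
    unfolding K_fusion_frame_def
  proof (intro conjI ballI)
    show "hilbert_space F ?S" by (rule sum.hilbert_space_axioms)
    show "bounded_operator F ?S (direct_sum_op m K)" using direct_sum_op_bounded K by blast
    show "closed_subspace F ?S (direct_sum_subspace m (W i))" if "i \<in> I" for i
      using direct_sum_subspace_closed[of "W i"] W that by blast
    show "\<exists>A>0. \<exists>B>0. \<forall>f\<in>carrier ?S.
      (\<lambda>i. (v i)\<^sup>2 * (hnorm ?S (orth_proj ?S (direct_sum_subspace m (W i)) f))\<^sup>2) summable_on I \<and>
      A * (hnorm ?S (adjoint_op ?S (direct_sum_op m K) f))\<^sup>2
        \<le> (\<Sum>\<^sub>\<infinity>i\<in>I. (v i)\<^sup>2 * (hnorm ?S (orth_proj ?S (direct_sum_subspace m (W i)) f))\<^sup>2) \<and>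
      (\<Sum>\<^sub>\<infinity>i\<in>I. (v i)\<^sup>2 * (hnorm ?S (orth_proj ?S (direct_sum_subspace m (W i)) f))\<^sup>2)
        \<le> B * (hnorm ?S f)\<^sup>2"
      using a0 b0 frame by blast
  qed (rule v)
qed

end
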